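(* Let $p,q\ge 1$ be integers and let $P$ be a non-degenerate $p\times q$ classical transportation polytope. Then the number of vertices of $P$ is divisible by $\gcd(p,q)$.
   Context: For $u\in\mathbb{R}^p$ and $v\in\mathbb{R}^q$, the $p\times q$ classical transportation polytope with marginals $u,v$ is $P=\{x=(x_{i,j})\in\mathbb{R}_{\ge 0}^{p\times q} : \sum_{j=1}^q x_{i,j}=u_i\ (i\in[p]),\ \sum_{i=1}^p x_{i,j}=v_j\ (j\in[q])\}$. A transportation polytope is called non-degenerate if it is a simple polytope of the maximal possible dimension, which for $p\times q$ classical transportation polytopes is $(p-1)(q-1)$. *)

theory Defs
  imports "HOL-Analysis.Analysis"
begin

(* x $ i $ j is the entry x_{i,j}; the row index type 'p has p elements and the
   column index type 'q has q elements. *)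
definition transportation_polytope :: "real ^ 'p \<Rightarrow> real ^ 'q \<Rightarrow> (real ^ 'q ^ 'p) set" where
  "transportation_polytope u v =
     {x. (\<forall>i j. 0 \<le> x $ i $ j) \<and>
         (\<forall>i. (\<Sum>j\<in>UNIV. x $ i $ j) = u $ i) \<and>
         (\<forall>j. (\<Sum>i\<in>UNIV. x $ i $ j) = v $ j)}"

definition vertices :: "'a::euclidean_space set \<Rightarrow> 'a set" where
  "vertices P = {x. x extreme_point_of P}"

(* A d-dimensional polytope is simple if each of its vertices lies on exactly d facets.
   Facets are facets of P as a convex set, not defining inequalities, so redundant
   or repeated inequalities play no role. *)
definition simple_polytope :: "'a::euclidean_space set \<Rightarrow> bool" where
  "simple_polytope P \<longleftrightarrow>
     polytope P \<and> (\<forall>x \<in> vertices P. int (card {F. F facet_of P \<and> x \<in> F}) = aff_dim P)"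

(* The maximal dimension of a p x q transportation polytope is (p - 1) * (q - 1).
   The empty set has aff_dim -1 and is therefore excluded. *)
definition nondegenerate :: "(real ^ 'q ^ 'p) set \<Rightarrow> bool" where
  "nondegenerate P \<longleftrightarrow>
     simple_polytope P \<and> aff_dim P = (int CARD('p) - 1) * (int CARD('q) - 1)"

end

(* The vertices of a generic transportation polytope are the spanning trees of K_{p,q} whose flow
   with the given marginals is positive. Move the marginals along a generic line until one of them
   is negative and no such tree is left. Whenever the flow on an edge e of a surviving tree T hits
   zero, the two components of F = T - e with vertex sets (A, B) and complement can be reconnected
   by any edge of A x B^c or of A^c x B; with c(i,j) = [i in A] - [j in B], the trees through edges
   with c = 1 die and those with c = -1 are born, or vice versa. So the number of trees changes by
   the sum of all c(i,j), up to sign, which is q|A| - p|B| and hence divisible by gcd(p,q). *)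

theory Submission
  imports Defs
begin

subsection \<open>Flows on spanning trees\<close>

text \<open>The obstacle: simplicity speaks of facets, so a vertex may have fewer than p + q - 1
  positive entries. For p = q = 2 and all marginals equal and positive, the polytope is a segment
  whose ends have two zeros each, while a spanning tree has three edges. So the given marginals need
  not be generic, and several trees may carry the same vertex. Remedy: keep one inequality per facet
  and leave the given marginals in a direction close to relaxing the others; then exactly one tree
  per vertex is positive just after time 0. This is why zero flow with positive derivative counts as
  alive. The line is not followed wall by wall. Pairs (T, e) of a tree and the edge at which it is
  born or dies at some time t > 0 are counted with sign in two ways: for fixed T the sum tells
  whether T is alive just after 0, for fixed T - e it is divisible by the gcd. Trees are handled by
  linear algebra: connectedness gives existence of flows, acyclicity uniqueness. Paths occur only in
  the construction of the cut potential.\<close>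

definition entry :: "real ^ 'q ^ 'p \<Rightarrow> 'p \<times> 'q \<Rightarrow> real" where
  "entry x e = x $ fst e $ snd e"

text \<open>The cycle space of K_{p,q}. Two matrices have the same marginals iff their difference
  lies in it, so marginals can be represented by any matrix that has them.\<close>

definition balanced :: "(real ^ 'q ^ 'p) set" where
  "balanced = {x. (\<forall>i. (\<Sum>j\<in>UNIV. x $ i $ j) = 0) \<and> (\<forall>j. (\<Sum>i\<in>UNIV. x $ i $ j) = 0)}"

definition supported :: "('p \<times> 'q) set \<Rightarrow> (real ^ 'q ^ 'p) set" where
  "supported T = {x. \<forall>e. e \<notin> T \<longrightarrow> entry x e = 0}"

definition ind_mat :: "('p \<times> 'q) set \<Rightarrow> real ^ 'q ^ 'p" where
  "ind_mat A = (\<chi> i j. if (i, j) \<in> A then 1 else 0)"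

text \<open>Connectedness of the bipartite graph \<open>T\<close>, expressed by potentials: a function that is
  \<open>\<alpha>\<close> on rows and \<open>-\<beta>\<close> on columns and constant along the edges is constant.\<close>

definition spanning :: "('p \<times> 'q) set \<Rightarrow> bool" where
  "spanning T \<longleftrightarrow>
     (\<forall>(\<alpha> :: 'p \<Rightarrow> real) \<beta>. (\<forall>(i, j) \<in> T. \<alpha> i + \<beta> j = 0) \<longrightarrow> (\<forall>i j. \<alpha> i + \<beta> j = 0))"

text \<open>The second condition is acyclicity: an alternating signed cycle inside \<open>T\<close>
  would be a nonzero balanced matrix supported on \<open>T\<close>.\<close>

definition tree :: "('p::finite \<times> 'q::finite) set \<Rightarrow> bool" where
  "tree T \<longleftrightarrow> spanning T \<and> (\<forall>x \<in> balanced. x \<in> supported T \<longrightarrow> x = 0)"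

text \<open>Depends on \<open>y\<close> only through its marginals. Letting \<open>y\<close> be a
  matrix makes the flow a linear map on a full Euclidean space, with no compatibility condition on
  row and column sums.\<close>

definition flow :: "('p::finite \<times> 'q::finite) set \<Rightarrow> real ^ 'q ^ 'p \<Rightarrow> real ^ 'q ^ 'p" where
  "flow T y = (THE x. x \<in> supported T \<and> x - y \<in> balanced)"

lemma entry_simps [simp]:
  "entry (x + y) e = entry x e + entry y e"
  "entry (x - y) e = entry x e - entry y e"
  "entry (c *\<^sub>R x) e = c * entry x e"
  "entry (- x) e = - entry x e"
  "entry 0 e = 0"
  "entry (ind_mat A) e = (if e \<in> A then 1 else 0)"
  by (simp_all add: entry_def ind_mat_def)

lemma linear_entry: "linear (\<lambda>x. entry x e)"
  by (rule linearI) simp_all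

lemma matrix_eqI: "(\<And>e. entry x e = entry y e) \<Longrightarrow> x = y"
  unfolding entry_def vec_eq_iff by (metis fst_conv snd_conv)

lemma subspace_balanced: "subspace balanced"
  by (auto simp: subspace_def balanced_def sum.distrib simp flip: sum_distrib_left)

lemma subspace_supported: "subspace (supported T)"
  by (auto simp: subspace_def supported_def)

lemma supportedD: "x \<in> supported T \<Longrightarrow> e \<notin> T \<Longrightarrow> entry x e = 0"
  unfolding supported_def by blast

lemma supportedI: "(\<And>e. e \<notin> T \<Longrightarrow> entry x e = 0) \<Longrightarrow> x \<in> supported T"
  unfolding supported_def by blast

lemma supported_mono: "S \<subseteq> T \<Longrightarrow> supported S \<subseteq> supported T"
  by (auto simp: supported_def)

lemma ind_mat_supported: "A \<subseteq> T \<Longrightarrow> ind_mat A \<in> supported T"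
  by (auto simp: supported_def)

lemma sum_entry:
  fixes g :: "'p::finite \<times> 'q::finite \<Rightarrow> 'a::comm_monoid_add"
  shows "(\<Sum>e\<in>UNIV. g e) = (\<Sum>i\<in>UNIV. \<Sum>j\<in>UNIV. g (i, j))"
  by (simp add: sum.cartesian_product UNIV_Times_UNIV[symmetric] del: UNIV_Times_UNIV)

lemma inner_entry: "x \<bullet> y = (\<Sum>e\<in>UNIV. entry x e * entry y e)"
  by (simp add: sum_entry inner_vec_def entry_def)

lemma inner_ind_mat: "x \<bullet> ind_mat {e} = entry x e"
  by (simp add: inner_entry if_distrib[of "\<lambda>z. _ * z"] cong: if_cong)

text \<open>Summing the \<alpha> part along rows and the \<beta> part along columns meets only zero
  sums. Later this acts as a conservation law across a cut.\<close>

lemma potential_orthogonal_balanced: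
  fixes z :: "real ^ 'q ^ 'p"
  assumes "z \<in> balanced"
  shows "(\<Sum>e\<in>UNIV. (\<alpha> (fst e) + \<beta> (snd e)) * entry z e) = 0"
proof -
  have "(\<Sum>e\<in>UNIV. (\<alpha> (fst e) + \<beta> (snd e)) * entry z e) =
      (\<Sum>i\<in>UNIV. \<Sum>j\<in>UNIV. \<alpha> i * z $ i $ j) + (\<Sum>i\<in>UNIV. \<Sum>j\<in>UNIV. \<beta> j * z $ i $ j)"
    by (simp add: sum_entry entry_def algebra_simps sum.distrib)
  also have "(\<Sum>i\<in>UNIV. \<Sum>j\<in>UNIV. \<beta> j * z $ i $ j) = (\<Sum>j\<in>UNIV. \<beta> j * (\<Sum>i\<in>UNIV. z $ i $ j))"
    by (subst sum.swap) (simp add: sum_distrib_left)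
  also have "(\<Sum>i\<in>UNIV. \<Sum>j\<in>UNIV. \<alpha> i * z $ i $ j) = (\<Sum>i\<in>UNIV. \<alpha> i * (\<Sum>j\<in>UNIV. z $ i $ j))"
    by (simp add: sum_distrib_left)
  finally show ?thesis
    using assms by (simp add: balanced_def)
qed

lemma sum_if_conj:
  fixes c :: "'c::finite"
  shows "(\<Sum>x\<in>UNIV. if a \<and> x = c then 1 else 0) = (of_bool a :: real)"
    "(\<Sum>x\<in>UNIV. if a \<and> c = x then 1 else 0) = (of_bool a :: real)"
    "(\<Sum>x\<in>UNIV. if x = c \<and> a then 1 else 0) = (of_bool a :: real)"
  by (cases a; simp)+

text \<open>The 4-cycle with alternating signs. Orthogonality to all of these forces a matrix into
  the form \<alpha> i + \<beta> j.\<close>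

lemma balanced_square:
  "ind_mat {(i, j)} - ind_mat {(i, j')} - ind_mat {(i', j)} + ind_mat {(i', j')} \<in> balanced"
  by (auto simp: balanced_def ind_mat_def sum.distrib sum_subtractf sum_if_conj)

text \<open>By duality: a matrix orthogonal to \<open>supported T\<close> vanishes on
  \<open>T\<close>, one orthogonal to \<open>balanced\<close> is a potential, and a potential
  vanishing on a spanning \<open>T\<close> is 0. Hence the two subspaces together span
  everything.\<close>

lemma spanning_flow_exists:
  fixes y :: "real ^ 'q ^ 'p"
  assumes "spanning T"
  shows "\<exists>x. x \<in> supported T \<and> x - y \<in> balanced"
proof -
  have "span (supported T \<union> balanced) = (UNIV :: (real ^ 'q ^ 'p) set)"
  proof (rule ccontr)
    assume "span (supported T \<union> balanced) \<noteq> (UNIV :: (real ^ 'q ^ 'p) set)"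
    then obtain z :: "real ^ 'q ^ 'p" where "z \<noteq> 0"
      and z: "\<And>x. x \<in> span (supported T \<union> balanced) \<Longrightarrow> z \<bullet> x = 0"
      using span_not_UNIV_orthogonal by metis
    obtain i0 :: 'p and j0 :: 'q where True by blast
    have zT: "entry z e = 0" if "e \<in> T" for e
      using z[OF span_base, of "ind_mat {e}"] that ind_mat_supported[of "{e}" T]
      by (simp add: inner_ind_mat)
    have pot: "entry z (i, j) = entry z (i, j0) + (entry z (i0, j) - entry z (i0, j0))" for i j
      using z[OF span_base, OF UnI2, OF balanced_square[of i j j0 i0]]
      by (simp add: inner_add_right inner_diff_right inner_ind_mat)
    have "\<forall>i j. entry z (i, j0) + (entry z (i0, j) - entry z (i0, j0)) = 0"
      using assms zT unfolding spanning_def pot[symmetric]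
      by (elim allE[of _ "\<lambda>i. entry z (i, j0)"] allE[of _ "\<lambda>j. entry z (i0, j) - entry z (i0, j0)"])
         (force simp flip: pot)
    then have "z = 0"
      by (intro matrix_eqI) (metis pot prod.collapse entry_simps(5))
    with \<open>z \<noteq> 0\<close> show False by simp
  qed
  then have "y \<in> span (supported T \<union> balanced)" by simp
  then obtain a b where "a \<in> supported T" "b \<in> balanced" "y = a + b"
    by (auto simp: span_Un span_eq_iff[THEN iffD2, OF subspace_balanced]
        span_eq_iff[THEN iffD2, OF subspace_supported])
  then show ?thesis
    by (intro exI[of _ a]) (auto simp: subspace_neg[OF subspace_balanced])
qed

lemma flow_unique:
  assumes "tree T" "x \<in> supported T" "x' \<in> supported T" "x - y \<in> balanced" "x' - y \<in> balanced"
  shows "x = x'"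
proof -
  have "x - x' \<in> balanced"
    using subspace_diff[OF subspace_balanced assms(4,5)] by simp
  moreover have "x - x' \<in> supported T"
    using subspace_diff[OF subspace_supported assms(2,3)] .
  ultimately show ?thesis using assms(1) unfolding tree_def by (metis eq_iff_diff_eq_0)
qed

lemma flow_eqI:
  assumes "tree T" "x \<in> supported T" "x - y \<in> balanced"
  shows "flow T y = x"
  unfolding flow_def by (rule the_equality) (use assms flow_unique in blast)+

lemma flow_props:
  assumes "tree T"
  shows "flow T y \<in> supported T" "flow T y - y \<in> balanced"
  using spanning_flow_exists[of T y] assms flow_eqI[OF assms] unfolding tree_def by metis+

lemma linear_flow: assumes "tree T" shows "linear (flow T)"
proof (rule linearI)
  fix x y c
  show "flow T (x + y) = flow T x + flow T y"
    using subspace_add[OF subspace_balanced flow_props(2)[OF assms, of x] flow_props(2)[OF assms, of y]]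
    by (intro flow_eqI assms subspace_add subspace_supported flow_props) (simp add: algebra_simps)
  show "flow T (c *\<^sub>R x) = c *\<^sub>R flow T x"
    using subspace_scale[OF subspace_balanced flow_props(2)[OF assms, of x], of c]
    by (intro flow_eqI assms subspace_scale subspace_supported flow_props) (simp add: algebra_simps)
qed

lemma flow_outside: "tree T \<Longrightarrow> e \<notin> T \<Longrightarrow> entry (flow T y) e = 0"
  using flow_props(1) by (rule supportedD)

lemma flow_supported: "tree T \<Longrightarrow> x \<in> supported T \<Longrightarrow> flow T x = x"
  by (rule flow_eqI) (simp_all add: subspace_0 subspace_balanced)

text \<open>A unit of flow on an edge of \<open>T\<close> outside \<open>S\<close> could be rerouted
  through \<open>S\<close>, giving two flows in \<open>T\<close> with the same marginals.\<close>

lemma tree_subset_eq: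
  assumes "spanning S" "tree T" "S \<subseteq> T"
  shows "S = T"
proof (rule ccontr)
  assume "S \<noteq> T"
  then obtain e where e: "e \<in> T" "e \<notin> S" using assms by blast
  obtain x where x: "x \<in> supported S" "x - ind_mat {e} \<in> balanced"
    using spanning_flow_exists[OF assms(1)] by blast
  have "x \<in> supported T" "ind_mat {e} \<in> supported T"
    using x(1) supported_mono[OF assms(3)] ind_mat_supported[of "{e}" T] e by auto
  then have "x = ind_mat {e}"
    using flow_unique[OF assms(2), of x "ind_mat {e}" "ind_mat {e}"] x(2)
    by (simp add: subspace_0 subspace_balanced)
  moreover have "entry x e = 0" using x(1) e(2) by (rule supportedD)
  ultimately show False by simp
qed

subsection \<open>The edges reconnecting a split tree\<close>

text \<open>With \<open>C\<close> the component in \<open>F\<close> of the row end of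
  \<open>e\<close>, the potential is 1 on the rows and -1 on the columns of \<open>C\<close>. If it
  vanished on \<open>e\<close>, both ends of \<open>e\<close> would lie in \<open>C\<close>; then
  any potential vanishing on \<open>F\<close> would vanish on \<open>e\<close> too, and
  \<open>F\<close> alone would be spanning, against the minimality of trees.\<close>

lemma tree_cut_potential:
  fixes F :: "('p::finite \<times> 'q::finite) set"
  assumes "tree (insert e F)" "e \<notin> F"
  obtains \<alpha> :: "'p \<Rightarrow> int" and \<beta> :: "'q \<Rightarrow> int" where
    "\<And>i j. (i, j) \<in> F \<Longrightarrow> \<alpha> i + \<beta> j = 0"
    "\<And>i j. \<alpha> i + \<beta> j \<in> {-1, 0, 1}"
    "\<alpha> (fst e) + \<beta> (snd e) \<noteq> 0"
proof -
  define r :: "('p + 'q) rel" where "r = {(Inl i, Inr j) | i j. (i, j) \<in> F}"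
  define C where "C = {n. (Inl (fst e), n) \<in> (r \<union> r\<inverse>)\<^sup>*}"
  define \<alpha> :: "'p \<Rightarrow> int" where "\<alpha> i = (if Inl i \<in> C then 1 else 0)" for i
  define \<beta> :: "'q \<Rightarrow> int" where "\<beta> j = (if Inr j \<in> C then -1 else 0)" for j
  have C: "Inl i \<in> C \<longleftrightarrow> Inr j \<in> C" if "(i, j) \<in> F" for i j
  proof -
    have "(Inl i, Inr j) \<in> r \<union> r\<inverse>" "(Inr j, Inl i) \<in> r \<union> r\<inverse>"
      using that by (auto simp: r_def)
    then show ?thesis unfolding C_def mem_Collect_eq by (meson rtrancl.rtrancl_into_rtrancl)
  qed
  have F: "\<alpha> i + \<beta> j = 0" if "(i, j) \<in> F" for i j
    using C[OF that] by (simp add: \<alpha>_def \<beta>_def)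
  have "\<alpha> (fst e) = 1" by (simp add: \<alpha>_def C_def)
  have "\<alpha> (fst e) + \<beta> (snd e) \<noteq> 0"
  proof
    assume e: "\<alpha> (fst e) + \<beta> (snd e) = 0"
    have "spanning F"
      unfolding spanning_def
    proof (intro allI impI)
      fix \<gamma> :: "'p \<Rightarrow> real" and \<delta> i j
      assume F0: "\<forall>(i, j)\<in>F. \<gamma> i + \<delta> j = 0"
      have "case n of Inl i \<Rightarrow> \<gamma> i = \<gamma> (fst e) | Inr j \<Rightarrow> - \<delta> j = \<gamma> (fst e)"
        if "(Inl (fst e), n) \<in> (r \<union> r\<inverse>)\<^sup>*" for n
        using that by (induction rule: rtrancl_induct) (use F0 in \<open>force simp: r_def\<close>)+
      moreover have "Inr (snd e) \<in> C"
        using e \<open>\<alpha> (fst e) = 1\<close> by (auto simp: \<beta>_def split: if_splits)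
      ultimately have "\<gamma> (fst e) + \<delta> (snd e) = 0"
        by (force simp: C_def)
      then have "\<forall>(i, j)\<in>insert e F. \<gamma> i + \<delta> j = 0"
        using F0 by auto
      then show "\<gamma> i + \<delta> j = 0"
        using assms(1) unfolding tree_def spanning_def by blast
    qed
    with assms(1) have "F = insert e F" by (intro tree_subset_eq) auto
    with assms(2) show False by blast
  qed
  with F show thesis
    by (intro that[of \<alpha> \<beta>]) (auto simp: \<alpha>_def \<beta>_def)
qed

text \<open>Modulo trivial ones, the potentials vanishing on \<open>F\<close> form a line spanned by
  \<alpha>, \<beta>, and \<open>e'\<close> restores connectedness exactly if this potential is
  nonzero there. For acyclicity, pairing a balanced matrix with the potential isolates its entry at
  \<open>e'\<close>, which must be 0.\<close>

lemma tree_exchange_iff: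
  fixes F :: "('p::finite \<times> 'q::finite) set"
  assumes tree: "tree (insert e F)"
    and F: "\<And>i j. (i, j) \<in> F \<Longrightarrow> \<alpha> i + \<beta> j = (0::real)"
    and e: "\<alpha> (fst e) + \<beta> (snd e) \<noteq> 0"
  shows "tree (insert e' F) \<longleftrightarrow> \<alpha> (fst e') + \<beta> (snd e') \<noteq> 0"
proof
  assume tr: "tree (insert e' F)"
  show "\<alpha> (fst e') + \<beta> (snd e') \<noteq> 0"
  proof
    assume "\<alpha> (fst e') + \<beta> (snd e') = 0"
    then have "\<forall>(i, j)\<in>insert e' F. \<alpha> i + \<beta> j = 0" using F by auto
    then show False using tr e unfolding tree_def spanning_def by blast
  qed
next
  assume e': "\<alpha> (fst e') + \<beta> (snd e') \<noteq> 0"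
  show "tree (insert e' F)"
    unfolding tree_def
  proof (intro conjI ballI impI)
    show "spanning (insert e' F)"
      unfolding spanning_def
    proof (intro allI impI)
      fix \<gamma> :: "'p \<Rightarrow> real" and \<delta> i j
      assume *: "\<forall>(i, j)\<in>insert e' F. \<gamma> i + \<delta> j = 0"
      \<comment> \<open>Chosen so that subtracting \<open>k\<close> times the cut potential yields a
        potential that vanishes on \<open>e\<close> as well.\<close>
      define k where "k = (\<gamma> (fst e) + \<delta> (snd e)) / (\<alpha> (fst e) + \<beta> (snd e))"
      have "\<forall>(i, j)\<in>insert e F. (\<gamma> i - k * \<alpha> i) + (\<delta> j - k * \<beta> j) = 0"
      proof -
        have "(\<gamma> i - k * \<alpha> i) + (\<delta> j - k * \<beta> j) = (\<gamma> i + \<delta> j) - k * (\<alpha> i + \<beta> j)" for i j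
          by (simp add: algebra_simps)
        moreover have "(\<gamma> i + \<delta> j) - k * (\<alpha> i + \<beta> j) = 0" if "(i, j) \<in> insert e F" for i j
          using that * F e by (cases "(i, j) = e") (auto simp: k_def)
        ultimately show ?thesis by (metis (mono_tags, lifting) case_prodI2)
      qed
      then have all: "(\<gamma> i - k * \<alpha> i) + (\<delta> j - k * \<beta> j) = 0" for i j
        using spec[OF spec[OF conjunct1[OF tree[unfolded tree_def spanning_def]],
              of "\<lambda>i. \<gamma> i - k * \<alpha> i"], of "\<lambda>j. \<delta> j - k * \<beta> j"]
        by blast
      have "k * (\<alpha> (fst e') + \<beta> (snd e')) = 0"
        using all[of "fst e'" "snd e'"] bspec[OF *, of e'] by (simp add: algebra_simps split_beta)
      then have "k = 0" using e' by simp
      then show "\<gamma> i + \<delta> j = 0" using all[of i j] by simp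
    qed
  next
    fix x :: "real ^ 'q ^ 'p"
    assume x: "x \<in> balanced" "x \<in> supported (insert e' F)"
    have "(\<Sum>a\<in>UNIV. (\<alpha> (fst a) + \<beta> (snd a)) * entry x a) =
        (\<Sum>a\<in>UNIV. if a = e' then (\<alpha> (fst e') + \<beta> (snd e')) * entry x e' else 0)"
    proof (rule sum.cong[OF refl])
      fix a
      show "(\<alpha> (fst a) + \<beta> (snd a)) * entry x a =
          (if a = e' then (\<alpha> (fst e') + \<beta> (snd e')) * entry x e' else 0)"
        using F[of "fst a" "snd a"] supportedD[OF x(2), of a] by auto
    qed
    then have "(\<alpha> (fst e') + \<beta> (snd e')) * entry x e' = 0"
      using potential_orthogonal_balanced[OF x(1), of \<alpha> \<beta>] by simp
    then have "x \<in> supported (insert e F)"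
      using x(2) e' by (auto simp: supported_def)
    then show "x = 0" using tree x(1) unfolding tree_def by blast
  qed
qed

subsection \<open>Wall crossing\<close>

lemma card_eq_of_bool:
  assumes "\<And>x. x \<in> A \<Longrightarrow> P" "P \<Longrightarrow> \<exists>x. x \<in> A" "\<And>x y. x \<in> A \<Longrightarrow> y \<in> A \<Longrightarrow> x = y"
  shows "card A = of_bool P"
proof (cases P)
  case True
  then obtain x where "x \<in> A" using assms(2) by blast
  then have "A = {x}" using assms(3) by blast
  then show ?thesis using True by simp
next
  case False
  then have "A = {}" using assms(1) by blast
  then show ?thesis using False by simp
qed

text \<open>The right-hand side says that all \<open>X e + t * D e\<close> are positive for small \<open>t > 0\<close>.\<close>

lemma crossing_count:
  fixes X D :: "'a \<Rightarrow> real"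
  assumes fin: "finite T" and D: "\<And>e. e \<in> T \<Longrightarrow> D e \<noteq> 0"
    and distinct: "\<And>e e' t. e \<in> T \<Longrightarrow> e' \<in> T \<Longrightarrow> t > 0 \<Longrightarrow> X e + t * D e = 0 \<Longrightarrow>
      X e' + t * D e' = 0 \<Longrightarrow> e = e'"
    and death: "\<And>t. t \<ge> t0 \<Longrightarrow> \<exists>e\<in>T. X e + t * D e \<le> 0"
  shows "(\<Sum>e | e \<in> T \<and> (\<exists>t>0. X e + t * D e = 0 \<and> (\<forall>e'\<in>T - {e}. X e' + t * D e' > 0)). - sgn (D e)) =
    of_bool (\<forall>e\<in>T. X e > 0 \<or> X e = 0 \<and> D e > 0)"
proof -
  \<comment> \<open>The zero of the affine function at \<open>e\<close>. Functions in
    \<open>U\<close> are positive after it, those in \<open>W\<close> before it, so all are positive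
    exactly between the last zero of \<open>U\<close> and the first zero of
    \<open>W\<close>.\<close>
  define \<tau> where "\<tau> e = - X e / D e" for e
  define U where "U = {e \<in> T. D e > 0}"
  define W where "W = {e \<in> T. D e < 0}"
  have fin': "finite U" "finite W" using fin by (auto simp: U_def W_def)
  have T: "T = U \<union> W" "U \<inter> W = {}" using D by (force simp: U_def W_def)+
  have eq: "X e + t * D e = 0 \<longleftrightarrow> t = \<tau> e" if "e \<in> T" for e t
    using D[OF that] by (auto simp: \<tau>_def field_simps)
  have U: "X e + t * D e > 0 \<longleftrightarrow> \<tau> e < t" if "e \<in> U" for e t
    using that by (auto simp: U_def \<tau>_def field_simps)
  have W: "X e + t * D e > 0 \<longleftrightarrow> t < \<tau> e" if "e \<in> W" for e t
    using that by (auto simp: W_def \<tau>_def field_simps)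
  define ev where "ev e \<longleftrightarrow> \<tau> e > 0 \<and> (\<forall>e'\<in>U - {e}. \<tau> e' < \<tau> e) \<and> (\<forall>e'\<in>W - {e}. \<tau> e < \<tau> e')" for e
  have ev: "{e. e \<in> T \<and> (\<exists>t>0. X e + t * D e = 0 \<and> (\<forall>e'\<in>T - {e}. X e' + t * D e' > 0))} =
      {e \<in> W. ev e} \<union> {e \<in> U. ev e}"
  proof -
    have "(\<exists>t>0. X e + t * D e = 0 \<and> (\<forall>e'\<in>T - {e}. X e' + t * D e' > 0)) \<longleftrightarrow> ev e" if "e \<in> T" for e
    proof -
      have "(\<exists>t>0. X e + t * D e = 0 \<and> (\<forall>e'\<in>T - {e}. X e' + t * D e' > 0)) \<longleftrightarrow>
          \<tau> e > 0 \<and> (\<forall>e'\<in>T - {e}. X e' + \<tau> e * D e' > 0)"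
        by (auto simp: eq[OF that])
      also have "\<dots> \<longleftrightarrow> ev e"
        unfolding ev_def T(1) using U W by blast
      finally show ?thesis .
    qed
    then show ?thesis using T(1) by blast
  qed
  have dist: "e = e'" if "e \<in> T" "e' \<in> T" "\<tau> e = \<tau> e'" "\<tau> e > 0" for e e'
    using distinct[of e e' "\<tau> e"] eq that by metis
  \<comment> \<open>With rising functions only, everything would be positive for large
    \<open>t\<close>, against \<open>death\<close>.\<close>
  have "W \<noteq> {}"
  proof
    assume "W = {}"
    define t where "t = Max (insert t0 (\<tau> ` U)) + 1"
    have "Max (insert t0 (\<tau> ` U)) \<ge> t0" using fin' by (intro Max_ge) auto
    then have "t \<ge> t0" by (simp add: t_def)
    moreover have "\<tau> e < t" if "e \<in> U" for e
    proof -
      have "\<tau> e \<le> Max (insert t0 (\<tau> ` U))" using fin' that by (intro Max_ge) auto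
      then show ?thesis by (simp add: t_def)
    qed
    ultimately show False using death[of t] U \<open>W = {}\<close> T(1) by (metis linorder_not_le sup_bot.right_neutral)
  qed
  \<comment> \<open>Within t > 0 all functions are positive exactly on the interval from
    \<open>r\<close> to \<open>s\<close>; the inserted 0 is the starting time. If
    \<open>r < s\<close>, the right end is an event of weight 1, and the left end one of weight -1
    when \<open>r > 0\<close>. What remains is 1 exactly if \<open>r = 0 < s\<close>, that is, if
    the interval begins at time 0. By \<open>dist\<close> each end is reached by a single
    edge.\<close>
  define s where "s = Min (\<tau> ` W)"
  define r where "r = Max (insert 0 (\<tau> ` U))"
  have s: "s \<le> \<tau> e" if "e \<in> W" for e using that fin' by (auto simp: s_def)
  have "s \<in> \<tau> ` W"
    unfolding s_def using fin' \<open>W \<noteq> {}\<close> by (intro Min_in) auto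
  then have s_ex: "\<exists>e\<in>W. \<tau> e = s" by blast
  have r: "\<tau> e \<le> r" if "e \<in> U" for e using that fin' by (auto simp: r_def)
  have r0: "r \<ge> 0" using fin' by (auto simp: r_def)
  have r_ex: "\<exists>e\<in>U. \<tau> e = r" if "r > 0"
  proof -
    have "r \<in> insert 0 (\<tau> ` U)" unfolding r_def using fin' by (intro Max_in) auto
    then show ?thesis using that by auto
  qed
  have r_less: "r < a \<longleftrightarrow> 0 < a \<and> (\<forall>e\<in>U. \<tau> e < a)" for a
    using fin' by (simp add: r_def)
  have evW: "ev e \<longleftrightarrow> \<tau> e = s \<and> r < s" if "e \<in> W" for e
  proof
    assume "ev e"
    moreover have "e \<notin> U" using that T(2) by blast
    ultimately have "r < \<tau> e" by (auto simp: r_less ev_def)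
    moreover obtain e' where "e' \<in> W" "\<tau> e' = s" using s_ex by blast
    moreover have "\<tau> e < \<tau> e'" if "e' \<noteq> e"
      using \<open>ev e\<close> \<open>e' \<in> W\<close> that unfolding ev_def by blast
    ultimately have "r < \<tau> e" "\<tau> e = s"
      using s[OF that] by fastforce+
    then show "\<tau> e = s \<and> r < s" by simp
  next
    assume *: "\<tau> e = s \<and> r < s"
    have "\<tau> e < \<tau> e'" if "e' \<in> W - {e}" for e'
    proof -
      have "\<tau> e \<noteq> \<tau> e'" using dist[of e e'] * r0 that \<open>e \<in> W\<close> T(1) by auto
      then show ?thesis using s[of e'] * that by simp
    qed
    then show "ev e" using * by (auto simp: ev_def r_less)
  qed
  have evU: "ev e \<longleftrightarrow> \<tau> e = r \<and> 0 < r \<and> r < s" if "e \<in> U" for e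
  proof
    assume "ev e"
    moreover have "e \<notin> W" using that T(2) by blast
    ultimately have "\<tau> e < s" using s_ex by (auto simp: ev_def)
    moreover have "0 < r" using \<open>ev e\<close> r[OF that] by (auto simp: ev_def)
    moreover obtain e' where "e' \<in> U" "\<tau> e' = r" using r_ex[OF \<open>0 < r\<close>] by blast
    moreover have "\<tau> e' < \<tau> e" if "e' \<noteq> e"
      using \<open>ev e\<close> \<open>e' \<in> U\<close> that unfolding ev_def by blast
    ultimately have "\<tau> e < s" "0 < r" "\<tau> e = r"
      using r[OF that] by fastforce+
    then show "\<tau> e = r \<and> 0 < r \<and> r < s" by simp
  next
    assume *: "\<tau> e = r \<and> 0 < r \<and> r < s"
    have "\<tau> e' < \<tau> e" if "e' \<in> U - {e}" for e'
    proof -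
      have "\<tau> e \<noteq> \<tau> e'" using dist[of e e'] * that \<open>e \<in> U\<close> T(1) by auto
      then show ?thesis using r[of e'] * that by simp
    qed
    moreover have "\<tau> e < \<tau> e'" if "e' \<in> W - {e}" for e'
      using s[of e'] that * by simp
    ultimately show "ev e" using * by (simp add: ev_def)
  qed
  have cW: "card {e \<in> W. ev e} = of_bool (r < s)"
  proof (rule card_eq_of_bool)
    show "r < s" if "e \<in> {e \<in> W. ev e}" for e using that evW by blast
    show "\<exists>e. e \<in> {e \<in> W. ev e}" if "r < s" using s_ex evW that by blast
    show "e = e'" if "e \<in> {e \<in> W. ev e}" "e' \<in> {e \<in> W. ev e}" for e e'
      using that evW[of e] evW[of e'] dist[of e e'] r0 T(1) by simp
  qed
  have cU: "card {e \<in> U. ev e} = of_bool (0 < r \<and> r < s)"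
  proof (rule card_eq_of_bool)
    show "0 < r \<and> r < s" if "e \<in> {e \<in> U. ev e}" for e using that evU by blast
    show "\<exists>e. e \<in> {e \<in> U. ev e}" if "0 < r \<and> r < s" using r_ex evU that by blast
    show "e = e'" if "e \<in> {e \<in> U. ev e}" "e' \<in> {e \<in> U. ev e}" for e e'
      using that evU[of e] evU[of e'] dist[of e e'] T(1) by simp
  qed
  have "(\<Sum>e\<in>{e \<in> W. ev e} \<union> {e \<in> U. ev e}. - sgn (D e)) =
      (\<Sum>e\<in>{e \<in> W. ev e}. - sgn (D e)) + (\<Sum>e\<in>{e \<in> U. ev e}. - sgn (D e))"
    using fin' T(2) by (intro sum.union_disjoint) auto
  also have "(\<Sum>e\<in>{e \<in> W. ev e}. - sgn (D e)) = (\<Sum>e\<in>{e \<in> W. ev e}. 1)"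
    by (rule sum.cong) (auto simp: W_def)
  also have "(\<Sum>e\<in>{e \<in> U. ev e}. - sgn (D e)) = (\<Sum>e\<in>{e \<in> U. ev e}. - 1)"
    by (rule sum.cong) (auto simp: U_def)
  finally have sum: "(\<Sum>e\<in>{e \<in> W. ev e} \<union> {e \<in> U. ev e}. - sgn (D e)) =
      of_bool (r < s) - of_bool (0 < r \<and> r < s)"
    by (simp add: cW cU)
  have "X e > 0 \<or> X e = 0 \<and> D e > 0 \<longleftrightarrow> \<tau> e \<le> 0" if "e \<in> U" for e
    using that by (auto simp: U_def \<tau>_def field_simps)
  moreover have "X e > 0 \<or> X e = 0 \<and> D e > 0 \<longleftrightarrow> 0 < \<tau> e" if "e \<in> W" for e
    using that by (auto simp: W_def \<tau>_def field_simps)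
  ultimately have alive: "(\<forall>e\<in>T. X e > 0 \<or> X e = 0 \<and> D e > 0) \<longleftrightarrow>
      (\<forall>e\<in>U. \<tau> e \<le> 0) \<and> (\<forall>e\<in>W. 0 < \<tau> e)"
    unfolding T(1) by blast
  have "(\<forall>e\<in>U. \<tau> e \<le> 0) \<longleftrightarrow> \<not> 0 < r"
    using r r_ex by (metis linorder_not_le order_trans)
  moreover have "(\<forall>e\<in>W. 0 < \<tau> e) \<longleftrightarrow> 0 < s"
    using s s_ex by (metis order_less_le_trans)
  ultimately show ?thesis
    unfolding ev sum alive using r0 by auto
qed

text \<open>At marginals \<open>x + t *\<^sub>R y\<close> the tree \<open>T\<close> is born or dies
  through the edge \<open>e\<close>, according to the sign of the flow of \<open>y\<close> on
  \<open>e\<close>.\<close>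

definition event :: "real ^ 'q ^ 'p \<Rightarrow> real ^ 'q ^ 'p \<Rightarrow> ('p::finite \<times> 'q::finite) set \<Rightarrow> 'p \<times> 'q \<Rightarrow> bool" where
  "event x y T e \<longleftrightarrow> (\<exists>t>0. entry (flow T x) e + t * entry (flow T y) e = 0 \<and>
     (\<forall>e'\<in>T - {e}. entry (flow T x) e' + t * entry (flow T y) e' > 0))"

text \<open>One event at \<open>F\<close> forces one for every reconnecting edge, at the same time:
  the flow at that moment vanishes on the exchanged edge, so it is supported on \<open>F\<close> and
  is the flow of all these trees.\<close>

lemma reconnect_sum:
  fixes F :: "('p::finite \<times> 'q::finite) set"
  shows "\<exists>k::int. (\<Sum>e | e \<notin> F \<and> tree (insert e F) \<and> event x y (insert e F) e.
      sgn (entry (flow (insert e F) y) e)) = of_int (k * int (gcd CARD('p) CARD('q)))"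
proof (cases "\<exists>e. e \<notin> F \<and> tree (insert e F) \<and> event x y (insert e F) e")
  case False
  then have "{e. e \<notin> F \<and> tree (insert e F) \<and> event x y (insert e F) e} = {}" by blast
  then have "(\<Sum>e | e \<notin> F \<and> tree (insert e F) \<and> event x y (insert e F) e.
      sgn (entry (flow (insert e F) y) e)) = of_int (0 * int (gcd CARD('p) CARD('q)))"
    by (simp only: sum.empty)
  then show ?thesis by blast
next
  case True
  then obtain e0 where e0: "e0 \<notin> F" "tree (insert e0 F)" "event x y (insert e0 F) e0" by blast
  obtain \<alpha> :: "'p \<Rightarrow> int" and \<beta> :: "'q \<Rightarrow> int" where
    F: "\<And>i j. (i, j) \<in> F \<Longrightarrow> \<alpha> i + \<beta> j = 0"
    and range: "\<And>i j. \<alpha> i + \<beta> j \<in> {-1, 0, 1}"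
    and ne: "\<alpha> (fst e0) + \<beta> (snd e0) \<noteq> 0"
    by (rule tree_cut_potential[OF e0(2,1)]) (rule that; assumption)
  define c where "c e = \<alpha> (fst e) + \<beta> (snd e)" for e
  have cF: "c e = 0" if "e \<in> F" for e using F[of "fst e" "snd e"] that by (simp add: c_def)
  have tree_iff: "tree (insert e F) \<longleftrightarrow> c e \<noteq> 0" for e
    using tree_exchange_iff[OF e0(2), of "\<lambda>i. real_of_int (\<alpha> i)" "\<lambda>j. real_of_int (\<beta> j)" e] F ne
    unfolding c_def by (simp flip: of_int_add)
  obtain t where t: "t > 0" "entry (flow (insert e0 F) x) e0 + t * entry (flow (insert e0 F) y) e0 = 0"
    "\<And>e'. e' \<in> F \<Longrightarrow> entry (flow (insert e0 F) x) e' + t * entry (flow (insert e0 F) y) e' > 0"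
    using e0(1,3) unfolding event_def by auto
  define w where "w = flow (insert e0 F) (x + t *\<^sub>R y)"
  have lin: "flow T (x + t *\<^sub>R y) = flow T x + t *\<^sub>R flow T y" if "tree T" for T
    by (simp add: linear_add[OF linear_flow[OF that]] linear_scale[OF linear_flow[OF that]])
  have wF: "w \<in> supported F"
  proof -
    have "entry w e0 = 0" using t(2) by (simp add: w_def lin e0)
    then show ?thesis
      using flow_outside[OF e0(2)] by (intro supportedI) (metis w_def insertE)
  qed
  have ev: "event x y (insert e F) e" if "e \<notin> F" "tree (insert e F)" for e
  proof -
    have "flow (insert e F) (x + t *\<^sub>R y) = w"
      using wF supported_mono[of F "insert e F"] flow_props(2)[OF e0(2)]
      by (intro flow_eqI that) (auto simp: w_def)
    then have "entry (flow (insert e F) x) e' + t * entry (flow (insert e F) y) e' = entry w e'" for e'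
      using lin[OF that(2)] by (metis entry_simps(1,3))
    moreover have "entry w e = 0" using wF that(1) by (rule supportedD)
    moreover have "entry w e' > 0" if "e' \<in> F" for e'
      using t(3)[OF that] by (simp add: w_def lin e0)
    ultimately show ?thesis unfolding event_def using t(1) by (intro exI[of _ t]) simp
  qed
  \<comment> \<open>The net supply of \<open>y\<close> across the cut. The potential kills balanced
    matrices and vanishes on \<open>F\<close>, so the reconnecting edge carries the supply alone; as
    \<open>c e\<close> is 1 or -1, the sign of its flow is \<open>sgn h * c e\<close>.\<close>
  define h where "h = (\<Sum>e\<in>UNIV. real_of_int (c e) * entry y e)"
  have h: "h = c e * entry (flow (insert e F) y) e" if "tree (insert e F)" for e
  proof -
    have "(\<Sum>a\<in>UNIV. real_of_int (c a) * entry (flow (insert e F) y - y) a) = 0"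
      using potential_orthogonal_balanced[OF flow_props(2)[OF that, of y], of
          "\<lambda>i. real_of_int (\<alpha> i)" "\<lambda>j. real_of_int (\<beta> j)"]
      by (simp add: c_def)
    then have "h = (\<Sum>a\<in>UNIV. real_of_int (c a) * entry (flow (insert e F) y) a)"
      by (simp add: h_def algebra_simps sum_subtractf)
    also have "\<dots> = (\<Sum>a\<in>UNIV. if a = e then c e * entry (flow (insert e F) y) e else 0)"
    proof (rule sum.cong[OF refl])
      fix a
      show "real_of_int (c a) * entry (flow (insert e F) y) a =
          (if a = e then c e * entry (flow (insert e F) y) e else 0)"
        using flow_outside[OF that, of a y] cF[of a] by (cases "a \<in> F") auto
    qed
    finally show ?thesis by simp
  qed
  obtain m :: int where m: "sgn h = of_int m"
    by (rule that[of "if h > 0 then 1 else if h = 0 then 0 else - 1"]) simp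
  have "(\<Sum>e | e \<notin> F \<and> tree (insert e F) \<and> event x y (insert e F) e. sgn (entry (flow (insert e F) y) e)) =
      (\<Sum>e | c e \<noteq> 0. sgn h * real_of_int (c e))"
  proof (rule sum.cong)
    show "{e. e \<notin> F \<and> tree (insert e F) \<and> event x y (insert e F) e} = {e. c e \<noteq> 0}"
      using ev tree_iff cF by blast
    fix e assume "e \<in> {e. c e \<noteq> 0}"
    then show "sgn (entry (flow (insert e F) y) e) = sgn h * real_of_int (c e)"
      using h[of e] range[of "fst e" "snd e"] by (auto simp: tree_iff sgn_mult simp flip: c_def)
  qed
  also have "\<dots> = (\<Sum>e\<in>UNIV. sgn h * real_of_int (c e))"
    by (rule sum.mono_neutral_left) auto
  also have "\<dots> = of_int (m * (\<Sum>e\<in>UNIV. c e))"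
    by (simp add: m sum_distrib_left)
  also have "(\<Sum>e\<in>UNIV. c e) = CARD('q) * (\<Sum>i\<in>UNIV. \<alpha> i) + CARD('p) * (\<Sum>j\<in>UNIV. \<beta> j)"
    unfolding c_def sum_entry by (simp add: sum.distrib sum_distrib_left)
  finally have eq: "(\<Sum>e | e \<notin> F \<and> tree (insert e F) \<and> event x y (insert e F) e. sgn (entry (flow (insert e F) y) e)) =
      of_int (m * (CARD('q) * (\<Sum>i\<in>UNIV. \<alpha> i) + CARD('p) * (\<Sum>j\<in>UNIV. \<beta> j)))" .
  have "int (gcd CARD('p) CARD('q)) dvd m * (CARD('q) * (\<Sum>i\<in>UNIV. \<alpha> i) + CARD('p) * (\<Sum>j\<in>UNIV. \<beta> j))"
    by (intro dvd_mult dvd_add dvd_mult2) (simp_all only: int_dvd_int_iff gcd_dvd1 gcd_dvd2)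
  then show ?thesis unfolding eq by (metis dvdE mult.commute)
qed

text \<open>The nonzero determinants in \<open>generic\<close> keep two edges of a tree from
  vanishing together at t > 0. Pairs on which the flow of \<open>x\<close> is 0 twice have to be
  excepted, since their determinant is 0 for every \<open>y\<close>; they do occur for degenerate
  starting marginals.\<close>

lemma card_alive_trees_dvd:
  fixes x y :: "real ^ 'q ^ 'p"
  assumes nz: "\<And>T e. tree T \<Longrightarrow> e \<in> T \<Longrightarrow> entry (flow T y) e \<noteq> 0"
    and generic: "\<And>T e e'. tree T \<Longrightarrow> e \<in> T \<Longrightarrow> e' \<in> T \<Longrightarrow> e \<noteq> e' \<Longrightarrow>
      entry (flow T x) e \<noteq> 0 \<or> entry (flow T x) e' \<noteq> 0 \<Longrightarrow>
      entry (flow T x) e * entry (flow T y) e' \<noteq> entry (flow T x) e' * entry (flow T y) e"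
    and death: "(\<Sum>j\<in>UNIV. y $ i $ j) < 0"
  shows "gcd CARD('p) CARD('q) dvd
    card {T. tree T \<and> (\<forall>e\<in>T. entry (flow T x) e > 0 \<or> entry (flow T x) e = 0 \<and> entry (flow T y) e > 0)}"
proof -
  define ev where "ev = event x y"
  define alive where "alive T \<longleftrightarrow>
    (\<forall>e\<in>T. entry (flow T x) e > 0 \<or> entry (flow T x) e = 0 \<and> entry (flow T y) e > 0)" for T
  have count: "(\<Sum>e | e \<in> T \<and> ev T e. - sgn (entry (flow T y) e)) = of_bool (alive T)" if T: "tree T" for T
    unfolding ev_def event_def alive_def
  proof (rule crossing_count)
    show "entry (flow T y) e \<noteq> 0" if "e \<in> T" for e using nz T that by blast
    show "e = e'" if "e \<in> T" "e' \<in> T" "t > 0" and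
      z: "entry (flow T x) e + t * entry (flow T y) e = 0"
         "entry (flow T x) e' + t * entry (flow T y) e' = 0" for e e' t
    proof (rule ccontr)
      assume "e \<noteq> e'"
      have X: "entry (flow T x) e = - t * entry (flow T y) e" "entry (flow T x) e' = - t * entry (flow T y) e'"
        using z by simp_all
      show False
        using generic[OF T that(1,2) \<open>e \<noteq> e'\<close>] nz[OF T that(1)] \<open>t > 0\<close> unfolding X by simp
    qed
    \<comment> \<open>Row \<open>i\<close> has marginal \<open>a - t * b\<close> at time
      \<open>t\<close>, which is negative from |a| / b + 1 on, so no tree keeps a nonnegative
      flow.\<close>
    define a where "a = (\<Sum>j\<in>UNIV. x $ i $ j)"
    define b where "b = - (\<Sum>j\<in>UNIV. y $ i $ j)"
    have "b > 0" using death by (simp add: b_def)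
    show "\<exists>e\<in>T. entry (flow T x) e + t * entry (flow T y) e \<le> 0" if t: "t \<ge> \<bar>a\<bar> / b + 1" for t
    proof (rule ccontr)
      assume "\<not> ?thesis"
      then have "entry (flow T x) e + t * entry (flow T y) e \<ge> 0" for e
        by (cases "e \<in> T") (auto simp: flow_outside[OF T])
      then have "0 \<le> (\<Sum>j\<in>UNIV. flow T x $ i $ j + t * flow T y $ i $ j)"
        by (intro sum_nonneg) (simp add: entry_def split: prod.splits, metis fst_conv snd_conv)
      also have "\<dots> = a - t * b"
        using flow_props(2)[OF T, of x] flow_props(2)[OF T, of y]
        by (simp add: balanced_def sum.distrib sum_subtractf a_def b_def flip: sum_distrib_left)
      also have "\<dots> \<le> a - (\<bar>a\<bar> / b + 1) * b"
        using t \<open>b > 0\<close> by simp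
      also have "\<dots> = (a - \<bar>a\<bar>) - b" using \<open>b > 0\<close> by (simp add: field_simps)
      also have "\<dots> < 0" using \<open>b > 0\<close> abs_ge_self[of a] by linarith
      finally show False by simp
    qed
  qed simp
  \<comment> \<open>The pairs counted twice: by tree, where \<open>count\<close> gives aliveness,
    and by the forest left after deleting the edge, where \<open>reconnect_sum\<close> gives
    divisibility.\<close>
  define E where "E = (SIGMA T:Collect tree. {e. e \<in> T \<and> ev T e})"
  define g where "g = (\<lambda>(T :: ('p \<times> 'q) set, e). sgn (entry (flow T y) e))"
  have "real (card {T. tree T \<and> alive T}) = (\<Sum>T | tree T. of_bool (alive T))"
    by (simp add: of_bool_def sum.If_cases Int_def)
  also have "\<dots> = (\<Sum>T | tree T. \<Sum>e | e \<in> T \<and> ev T e. - sgn (entry (flow T y) e))"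
    by (rule sum.cong) (simp_all add: count)
  also have "\<dots> = - sum g E"
    unfolding E_def g_def by (simp add: sum.Sigma sum_negf)
  also have "sum g E = (\<Sum>F\<in>UNIV. sum g {z \<in> E. fst z - {snd z} = F})"
    by (rule sum.group[symmetric]) auto
  also have "\<dots> = (\<Sum>F\<in>UNIV. \<Sum>e | e \<notin> F \<and> tree (insert e F) \<and> ev (insert e F) e.
      sgn (entry (flow (insert e F) y) e))"
  proof (rule sum.cong[OF refl])
    fix F :: "('p \<times> 'q) set"
    show "sum g {z \<in> E. fst z - {snd z} = F} =
        (\<Sum>e | e \<notin> F \<and> tree (insert e F) \<and> ev (insert e F) e. sgn (entry (flow (insert e F) y) e))"
      by (rule sum.reindex_bij_witness[where i = "\<lambda>e. (insert e F, e)" and j = snd])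
         (auto simp: E_def g_def insert_absorb)
  qed
  finally have eq: "real (card {T. tree T \<and> alive T}) =
    - (\<Sum>F\<in>UNIV. \<Sum>e | e \<notin> F \<and> tree (insert e F) \<and> ev (insert e F) e.
      sgn (entry (flow (insert e F) y) e))" .
  have "\<forall>F. \<exists>k::int. (\<Sum>e | e \<notin> F \<and> tree (insert e F) \<and> ev (insert e F) e.
      sgn (entry (flow (insert e F) y) e)) = of_int (k * int (gcd CARD('p) CARD('q)))"
    unfolding ev_def by (intro allI reconnect_sum)
  from choice[OF this] obtain k :: "('p \<times> 'q) set \<Rightarrow> int" where
    k: "\<forall>F. (\<Sum>e | e \<notin> F \<and> tree (insert e F) \<and> ev (insert e F) e.
      sgn (entry (flow (insert e F) y) e)) = of_int (k F * int (gcd CARD('p) CARD('q)))"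
    by blast
  have "real_of_int (int (card {T. tree T \<and> alive T})) =
      of_int ((- (\<Sum>F\<in>UNIV. k F)) * int (gcd CARD('p) CARD('q)))"
    unfolding of_int_of_nat_eq eq k[rule_format] by (simp add: sum_distrib_right)
  then have "int (card {T. tree T \<and> alive T}) = (- (\<Sum>F\<in>UNIV. k F)) * int (gcd CARD('p) CARD('q))"
    by (simp only: of_int_eq_iff)
  then have "int (gcd CARD('p) CARD('q)) dvd int (card {T. tree T \<and> alive T})"
    by (simp only: dvd_triv_right)
  then show ?thesis
    unfolding int_dvd_int_iff alive_def .
qed

subsection \<open>The geometry of a simple transportation polytope\<close>

definition restrict_mat :: "('p \<times> 'q) set \<Rightarrow> real ^ 'q ^ 'p \<Rightarrow> real ^ 'q ^ 'p" where
  "restrict_mat A x = (\<chi> i j. if (i, j) \<in> A then x $ i $ j else 0)"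

lemma entry_restrict_mat [simp]: "entry (restrict_mat A x) e = (if e \<in> A then entry x e else 0)"
  by (simp add: entry_def restrict_mat_def)

lemma linear_restrict_mat: "linear (restrict_mat A)"
  by (rule linearI; rule matrix_eqI) simp_all

lemma restrict_mat_supported: "restrict_mat A x \<in> supported A"
  by (simp add: supported_def)

lemma dim_supported_le:
  fixes A :: "('p::finite \<times> 'q::finite) set"
  shows "dim (supported A) \<le> card A"
proof -
  have "x \<in> span ((\<lambda>e. ind_mat {e}) ` A)" if "x \<in> supported A" for x :: "real ^ 'q ^ 'p"
  proof -
    have "x = (\<Sum>e\<in>A. entry x e *\<^sub>R ind_mat {e})"
    proof (rule matrix_eqI)
      fix e
      have "entry (\<Sum>e\<in>A. entry x e *\<^sub>R ind_mat {e}) e = (\<Sum>a\<in>A. if e = a then entry x a else 0)"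
        by (subst linear_sum[OF linear_entry]) (simp add: if_distrib[of "\<lambda>z. _ * z"] cong: if_cong)
      then show "entry x e = entry (\<Sum>e\<in>A. entry x e *\<^sub>R ind_mat {e}) e"
        using supportedD[OF that, of e] by simp
    qed
    also have "\<dots> \<in> span ((\<lambda>e. ind_mat {e}) ` A)"
      by (intro span_sum span_scale span_base imageI)
    finally show ?thesis .
  qed
  then have "dim (supported A) \<le> card ((\<lambda>e. ind_mat {e} :: real ^ 'q ^ 'p) ` A)"
    by (intro dim_le_card) auto
  also have "\<dots> \<le> card A" by (rule card_image_le) simp
  finally show ?thesis .
qed

text \<open>The hypothesis makes restriction to \<open>A\<close> injective on balanced matrices. It
  serves for the entries off one row and column, and for the zeros of a vertex.\<close>

lemma dim_restrict_balanced:
  fixes A :: "('p::finite \<times> 'q::finite) set"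
  assumes "\<And>x. x \<in> balanced \<Longrightarrow> x \<in> supported (- A) \<Longrightarrow> x = 0"
  shows "dim (restrict_mat A ` balanced) = dim (balanced :: (real ^ 'q::finite ^ 'p::finite) set)"
proof (rule dim_image_eq[OF linear_restrict_mat])
  show "inj_on (restrict_mat A) (span balanced)"
    unfolding span_eq_iff[THEN iffD2, OF subspace_balanced]
  proof (rule inj_onI)
    fix x y :: "real ^ 'q ^ 'p"
    assume xy: "x \<in> balanced" "y \<in> balanced" "restrict_mat A x = restrict_mat A y"
    have "entry (x - y) e = 0" if "e \<in> A" for e
      using that arg_cong[OF xy(3), of "\<lambda>z. entry z e"] by simp
    then have "x - y \<in> supported (- A)"
      unfolding supported_def by blast
    then show "x = y"
      using assms[OF subspace_diff[OF subspace_balanced xy(1,2)]] by simp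
  qed
qed

text \<open>The entries off one row and one column determine a balanced matrix, as its zero sums
  recover the rest.\<close>

lemma dim_balanced_le:
  "dim (balanced :: (real ^ 'q::finite ^ 'p::finite) set) \<le> (CARD('p) - 1) * (CARD('q) - 1)"
proof -
  obtain i0 :: 'p and j0 :: 'q where True by blast
  define A where "A = (- {i0}) \<times> (- {j0})"
  have "x = 0" if x: "x \<in> balanced" "x \<in> supported (- A)" for x :: "real ^ 'q ^ 'p"
  proof -
    have A: "x $ i $ j = 0" if "i \<noteq> i0" "j \<noteq> j0" for i j
      using supportedD[OF x(2), of "(i, j)"] that by (simp add: A_def entry_def)
    have rows: "(\<Sum>j\<in>UNIV. x $ i $ j) = 0" and cols: "(\<Sum>i\<in>UNIV. x $ i $ j) = 0" for i j
      using x(1) by (auto simp: balanced_def)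
    have 1: "x $ i $ j0 = 0" if "i \<noteq> i0" for i
    proof -
      have "(\<Sum>j\<in>UNIV. x $ i $ j) = (\<Sum>j\<in>UNIV. if j = j0 then x $ i $ j0 else 0)"
        by (rule sum.cong) (use A that in auto)
      then show ?thesis using rows by simp
    qed
    have "x $ i0 $ j = 0" for j
    proof -
      have "x $ i $ j = 0" if "i \<noteq> i0" for i
        using A 1 that by (cases "j = j0") auto
      then       have "(\<Sum>i\<in>UNIV. x $ i $ j) = (\<Sum>i\<in>UNIV. if i = i0 then x $ i0 $ j else 0)"
        by (intro sum.cong) auto
      then show ?thesis using cols by simp
    qed
    with A 1 show "x = 0"
      by (intro matrix_eqI) (metis entry_def entry_simps(5))
  qed
  then have "dim (balanced :: (real ^ 'q ^ 'p) set) = dim (restrict_mat A ` balanced :: (real ^ 'q ^ 'p) set)"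
    by (rule dim_restrict_balanced[symmetric])
  also have "\<dots> \<le> dim (supported A :: (real ^ 'q ^ 'p) set)"
    by (intro dim_subset) (auto simp: restrict_mat_supported)
  also have "\<dots> \<le> card A" by (rule dim_supported_le)
  also have "card A = (CARD('p) - 1) * (CARD('q) - 1)"
    by (simp add: A_def card_cartesian_product Compl_eq_Diff_UNIV card_Diff_subset)
  finally show ?thesis .
qed

lemma transportation_polytope_eq:
  assumes "x0 \<in> transportation_polytope u v"
  shows "transportation_polytope u v = {x. x - x0 \<in> balanced \<and> (\<forall>e. 0 \<le> entry x e)}"
  using assms by (auto simp: transportation_polytope_def balanced_def sum_subtractf entry_def)

text \<open>A squeeze: the dimension of \<open>P\<close> is at most that of \<open>balanced\<close>,
  which is at most (p-1)(q-1).\<close>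

lemma affine_hull_translate_balanced:
  fixes P :: "(real ^ 'q ^ 'p) set"
  assumes x0: "x0 \<in> P" and P: "P \<subseteq> {x. x - x0 \<in> balanced}"
    and dim: "aff_dim P = (int CARD('p) - 1) * (int CARD('q) - 1)"
  shows "affine hull P = {x. x - x0 \<in> balanced}"
    and "dim (balanced :: (real ^ 'q ^ 'p) set) = (CARD('p) - 1) * (CARD('q) - 1)"
proof -
  let ?L = "{x. x - x0 \<in> balanced}"
  have L: "?L = (+) x0 ` balanced" by (force simp: image_def)
  have aff: "affine ?L"
    unfolding L using subspace_balanced affine_translation subspace_imp_affine by blast
  have sub: "affine hull P \<subseteq> ?L" using P aff by (rule hull_minimal)
  have D: "(int CARD('p) - 1) * (int CARD('q) - 1) = int ((CARD('p) - 1) * (CARD('q) - 1))"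
    by (simp add: of_nat_diff Suc_le_eq)
  have "aff_dim ?L = int (dim (balanced :: (real ^ 'q ^ 'p) set))"
    unfolding L by (simp add: aff_dim_translation_eq aff_dim_subspace subspace_balanced)
  moreover have "aff_dim P \<le> aff_dim ?L" using P by (rule aff_dim_subset)
  moreover have "dim (balanced :: (real ^ 'q ^ 'p) set) \<le> (CARD('p) - 1) * (CARD('q) - 1)"
    by (rule dim_balanced_le)
  ultimately have eq: "aff_dim P = aff_dim ?L"
    and "dim (balanced :: (real ^ 'q ^ 'p) set) = (CARD('p) - 1) * (CARD('q) - 1)"
    using dim D by linarith+
  then show "dim (balanced :: (real ^ 'q ^ 'p) set) = (CARD('p) - 1) * (CARD('q) - 1)" by simp
  show "affine hull P = ?L"
    by (rule affine_dim_equal) (use aff sub eq x0 in \<open>auto simp: affine_affine_hull aff_dim_affine_hull\<close>)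
qed

text \<open>Positive values tolerate a small change and zeros move in the direction of
  \<open>b\<close>; finitely many such conditions share a step.\<close>

lemma small_step:
  fixes a b :: "'e \<Rightarrow> real"
  assumes "finite A" "\<And>e. e \<in> A \<Longrightarrow> a e > 0 \<or> a e = 0 \<and> b e \<ge> 0"
  shows "\<exists>\<delta>>0. \<forall>e\<in>A. 0 \<le> a e + \<delta> * b e"
proof -
  have "\<forall>\<^sub>F \<delta> in at_right 0. 0 \<le> a e + \<delta> * b e" if "e \<in> A" for e
    using assms(2)[OF that]
  proof
    assume "a e > 0"
    moreover have "((\<lambda>\<delta>. a e + \<delta> * b e) \<longlongrightarrow> a e + 0 * b e) (at_right 0)"
      by (intro tendsto_intros)
    ultimately have "\<forall>\<^sub>F \<delta> in at_right 0. 0 < a e + \<delta> * b e"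
      by (intro order_tendstoD) simp_all
    then show ?thesis by (rule eventually_mono) simp
  next
    assume "a e = 0 \<and> b e \<ge> 0"
    then show ?thesis
      using eventually_at_right_less[of "0::real"] by (auto elim!: eventually_mono)
  qed
  then have "\<forall>\<^sub>F \<delta> in at_right 0. 0 < \<delta> \<and> (\<forall>e\<in>A. 0 \<le> a e + \<delta> * b e)"
    using assms(1) by (intro eventually_conj eventually_at_right_less eventually_ball_finite) auto
  then show ?thesis
    using eventually_happens[of _ "at_right (0::real)"] by (auto simp: trivial_limit_at_right_real)
qed

text \<open>Simplicity only counts facets, so some of the inequalities \<open>x\<^sub>e \<ge> 0\<close> may be redundant.
  \<open>S\<close> is a minimal set of them that cuts out \<open>P\<close>; it has one member for each facet.\<close>

lemma facet_coordinates:
  fixes P :: "(real ^ 'q ^ 'p) set"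
  assumes "x0 \<in> P" and P: "P = {x. x - x0 \<in> balanced \<and> (\<forall>e. 0 \<le> entry x e)}"
    and hull: "affine hull P = {x. x - x0 \<in> balanced}"
  obtains S where "P = {x. x - x0 \<in> balanced \<and> (\<forall>e\<in>S. 0 \<le> entry x e)}"
    and "\<And>x. x \<in> P \<Longrightarrow> card {F. F facet_of P \<and> x \<in> F} = card (S \<inter> {e. entry x e = 0})"
proof -
  define cut where "cut S = {x. x - x0 \<in> balanced \<and> (\<forall>e\<in>S. 0 \<le> entry x e)}" for S
  have "\<exists>S. P = cut S" by (rule exI[of _ UNIV]) (simp add: cut_def P)
  \<comment> \<open>Least cardinality makes each inequality irredundant, as required for reading
    facets and relative interior off a description of a polyhedron.\<close>
  then obtain S where S: "P = cut S" and least: "\<And>S'. P = cut S' \<Longrightarrow> card S \<le> card S'"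
    using ex_has_least_nat[of "\<lambda>S. P = cut S" _ card] by blast
  have minimal: "P \<subset> cut S'" if "S' \<subset> S" for S'
  proof -
    have "P \<subseteq> cut S'" using that unfolding S cut_def by blast
    moreover have "P \<noteq> cut S'" using least[of S'] psubset_card_mono[OF _ that] by auto
    ultimately show ?thesis by blast
  qed
  define h where "h e = {x :: real ^ 'q ^ 'p. - ind_mat {e} \<bullet> x \<le> 0}" for e
  have h: "x \<in> h e \<longleftrightarrow> 0 \<le> entry x e" for x e
    by (simp add: h_def inner_ind_mat inner_commute[of _ x])
  have "inj h"
  proof (rule injI, rule ccontr)
    fix e e' assume "h e = h e'" "e \<noteq> e'"
    then show False using h[of "- ind_mat {e}" e] h[of "- ind_mat {e}" e'] by simp
  qed
  \<comment> \<open>The polyhedron facts index normals by half-spaces, so the coordinate has to be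
    recovered from its half-space.\<close>
  define a where "a H = - ind_mat {inv h H}" for H
  have a: "a (h e) = - ind_mat {e}" for e
    by (simp add: a_def \<open>inj h\<close>)
  have ne: "- ind_mat {e} \<noteq> 0" for e :: "'p \<times> 'q"
  proof
    assume "- ind_mat {e} = 0"
    then have "entry (- ind_mat {e}) e = 0" by (simp only: entry_simps(5))
    then show False by simp
  qed
  have cut_h: "affine hull P \<inter> \<Inter>(h ` S') = cut S'" for S'
    by (auto simp: hull cut_def h)
  have fin: "finite (h ` S)" by simp
  have seq: "P = affine hull P \<inter> \<Inter>(h ` S)" unfolding cut_h by (rule S)
  have faceq: "a H \<noteq> 0 \<and> H = {x. a H \<bullet> x \<le> 0}" if "H \<in> h ` S" for H
    using that ne by (auto simp: a) (auto simp: h_def)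
  have psub: "P \<subset> affine hull P \<inter> \<Inter>F'" if "F' \<subset> h ` S" for F'
  proof -
    define S' where "S' = {e \<in> S. h e \<in> F'}"
    have S': "F' = h ` S'" "S' \<subset> S" using that unfolding S'_def by blast+
    show ?thesis unfolding S'(1) cut_h by (rule minimal[OF S'(2)])
  qed
  define face where "face e = {x \<in> P. entry x e = 0}" for e
  have facets: "C facet_of P \<longleftrightarrow> C \<in> face ` S" for C
  proof -
    have "P \<inter> {x. a (h e) \<bullet> x = 0} = face e" for e
      by (auto simp: a face_def inner_ind_mat inner_commute[of "ind_mat _"])
    moreover have "C facet_of P \<longleftrightarrow> (\<exists>H. H \<in> h ` S \<and> C = P \<inter> {x. a H \<bullet> x = 0})"
      by (rule facet_of_polyhedron_explicit[where a = a and b = "\<lambda>_. 0", OF fin seq faceq psub])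
    ultimately show ?thesis by auto
  qed
  have rel: "rel_interior P = {x \<in> P. \<forall>H\<in>h ` S. a H \<bullet> x < 0}"
    by (rule rel_interior_polyhedron_explicit[where a = a and b = "\<lambda>_. 0", OF fin seq faceq psub])
  have "convex P"
    by (subst seq, intro convex_Int convex_Inter convex_affine_hull)
      (auto simp: h_def convex_halfspace_le simp del: inner_minus_left)
  then obtain c where "c \<in> rel_interior P"
    using \<open>x0 \<in> P\<close> rel_interior_eq_empty by blast
  then have c: "c \<in> P" "\<And>e. e \<in> S \<Longrightarrow> 0 < entry c e"
    by (auto simp: rel a inner_ind_mat inner_commute[of "ind_mat _"])
  \<comment> \<open>Separates the faces, so that counting facets amounts to counting coordinates.
    The point lies on the segment from the relatively interior \<open>c\<close> to some
    \<open>w\<close> that violates only the inequality of \<open>e\<close> among those in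
    \<open>S\<close>.\<close>
  have point: "\<exists>z\<in>face e. \<forall>e'\<in>S - {e}. 0 < entry z e'" if "e \<in> S" for e
  proof -
    obtain w where w: "w \<in> cut (S - {e})" "w \<notin> P" using minimal[of "S - {e}"] \<open>e \<in> S\<close> by blast
    then have we: "entry w e < 0" unfolding S cut_def by force
    define s where "s = entry c e / (entry c e - entry w e)"
    have s: "0 < s" "s < 1" using we c(2)[OF that] by (auto simp: s_def)
    define z where "z = c + s *\<^sub>R (w - c)"
    have ze: "entry z e = 0" using we c(2)[OF that] by (simp add: z_def s_def field_simps)
    have pos: "0 < entry z e'" if "e' \<in> S - {e}" for e'
    proof -
      have "entry z e' = (1 - s) * entry c e' + s * entry w e'" by (simp add: z_def algebra_simps)
      moreover have "0 < (1 - s) * entry c e'" "0 \<le> s * entry w e'"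
        using s c(2) w(1) that by (auto simp: cut_def)
      ultimately show ?thesis by linarith
    qed
    have "c - x0 \<in> balanced" "w - x0 \<in> balanced" using c(1) w(1) by (auto simp: P cut_def)
    moreover have "z - x0 = (1 - s) *\<^sub>R (c - x0) + s *\<^sub>R (w - x0)" by (simp add: z_def algebra_simps)
    ultimately have "z - x0 \<in> balanced"
      by (simp only: subspace_add subspace_scale subspace_balanced)
    then have "z \<in> P" using ze pos unfolding S cut_def by force
    then have "z \<in> face e" using ze by (simp add: face_def)
    with pos show ?thesis by blast
  qed
  have inj: "inj_on face S"
  proof (rule inj_onI, rule ccontr)
    fix e e' assume *: "e \<in> S" "e' \<in> S" "face e = face e'" "e \<noteq> e'"
    then obtain z where "z \<in> face e" "0 < entry z e'" using point[of e] by blast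
    moreover from this have "z \<in> face e'" using *(3) by simp
    ultimately show False by (simp add: face_def)
  qed
  show thesis
  proof (rule that[of S])
    show "P = {x. x - x0 \<in> balanced \<and> (\<forall>e\<in>S. 0 \<le> entry x e)}" using S unfolding cut_def .
    fix x assume "x \<in> P"
    then have "{F. F facet_of P \<and> x \<in> F} = face ` (S \<inter> {e. entry x e = 0})"
      by (auto simp: facets face_def)
    then show "card {F. F facet_of P \<and> x \<in> F} = card (S \<inter> {e. entry x e = 0})"
      using card_image[OF inj_on_subset[OF inj, of "S \<inter> {e. entry x e = 0}"]] by simp
  qed
qed

text \<open>Let \<open>Z\<close> be the zeros of \<open>x\<close> in \<open>S\<close>. Extremality
  leaves no nonzero balanced matrix vanishing on \<open>Z\<close>, which is acyclicity of the
  complement. Since |Z| equals the dimension of \<open>balanced\<close> (here simplicity enters),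
  restriction to \<open>Z\<close> is also onto, and this yields connectedness.\<close>

lemma vertex_tree:
  fixes P :: "(real ^ 'q ^ 'p) set"
  assumes P: "P = {x. x - x0 \<in> balanced \<and> (\<forall>e\<in>S. 0 \<le> entry x e)}"
    and x: "x extreme_point_of P"
    and card: "card (S \<inter> {e. entry x e = 0}) = dim (balanced :: (real ^ 'q ^ 'p) set)"
  shows "tree (- (S \<inter> {e. entry x e = 0}))"
proof -
  define Z where "Z = S \<inter> {e. entry x e = 0}"
  have xP: "x \<in> P" using x by (simp add: extreme_point_of_def)
  have indep: "y = 0" if y: "y \<in> balanced" "y \<in> supported (- Z)" for y
  proof (rule ccontr)
    assume "y \<noteq> 0"
    have step: "entry x e > 0 \<or> entry x e = 0 \<and> entry y' e \<ge> 0" if "e \<in> S" "y' = y \<or> y' = - y" for e y'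
      using xP that supportedD[OF y(2), of e] by (force simp: P Z_def)
    obtain \<delta>1 \<delta>2 where d: "\<delta>1 > 0" "\<forall>e\<in>S. 0 \<le> entry x e + \<delta>1 * entry y e"
      "\<delta>2 > 0" "\<forall>e\<in>S. 0 \<le> entry x e + \<delta>2 * entry (- y) e"
      using small_step[of S "entry x" "entry y"] small_step[of S "entry x" "entry (- y)"] step
      by (metis finite)
    have "x + \<delta>1 *\<^sub>R y \<in> P" "x - \<delta>2 *\<^sub>R y \<in> P"
    proof -
      have "x + c *\<^sub>R y - x0 \<in> balanced" for c
      proof -
        have "(x - x0) + c *\<^sub>R y \<in> balanced"
          using xP y(1) by (intro subspace_add subspace_scale subspace_balanced) (simp_all add: P)
        then show ?thesis by (simp add: algebra_simps)
      qed
      from this[of \<delta>1] this[of "- \<delta>2"] d show "x + \<delta>1 *\<^sub>R y \<in> P" "x - \<delta>2 *\<^sub>R y \<in> P"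
        by (auto simp: P)
    qed
    moreover have "x \<in> open_segment (x + \<delta>1 *\<^sub>R y) (x - \<delta>2 *\<^sub>R y)"
    proof -
      define s where "s = \<delta>1 / (\<delta>1 + \<delta>2)"
      have s: "0 < s" "s < 1" using d by (auto simp: s_def)
      have "(1 - s) * \<delta>1 - s * \<delta>2 = 0" using d by (simp add: s_def field_simps)
      moreover have "(1 - s) *\<^sub>R (x + \<delta>1 *\<^sub>R y) + s *\<^sub>R (x - \<delta>2 *\<^sub>R y) = x + ((1 - s) * \<delta>1 - s * \<delta>2) *\<^sub>R y"
        by (simp add: algebra_simps)
      moreover have "x + \<delta>1 *\<^sub>R y \<noteq> x - \<delta>2 *\<^sub>R y"
      proof
        assume "x + \<delta>1 *\<^sub>R y = x - \<delta>2 *\<^sub>R y"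
        then have "(\<delta>1 + \<delta>2) *\<^sub>R y = 0" by (simp add: algebra_simps)
        then show False using d \<open>y \<noteq> 0\<close> by simp
      qed
      ultimately show ?thesis using s by (auto simp: in_segment intro!: exI[of _ s])
    qed
    ultimately show False using x unfolding extreme_point_of_def by blast
  qed
  have dimZ: "dim (restrict_mat Z ` balanced :: (real ^ 'q ^ 'p) set) = dim (balanced :: (real ^ 'q ^ 'p) set)"
    by (rule dim_restrict_balanced) (rule indep)
  have "restrict_mat Z ` balanced = (supported Z :: (real ^ 'q ^ 'p) set)"
  proof (rule subspace_dim_equal)
    show "subspace (restrict_mat Z ` balanced :: (real ^ 'q ^ 'p) set)"
      by (rule linear_subspace_image[OF linear_restrict_mat subspace_balanced])
    show "dim (supported Z :: (real ^ 'q ^ 'p) set) \<le> dim (restrict_mat Z ` balanced :: (real ^ 'q ^ 'p) set)"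
      unfolding dimZ using dim_supported_le[of Z] card by (simp add: Z_def)
  qed (auto simp: subspace_supported restrict_mat_supported)
  then have ex: "\<exists>y\<in>balanced. restrict_mat Z y = (ind_mat {e} :: real ^ 'q ^ 'p)" if "e \<in> Z" for e
    using ind_mat_supported[of "{e}" Z] that by (metis empty_subsetI imageE insert_subset)
  have "spanning (- Z)"
    unfolding spanning_def
  proof (intro allI impI)
    fix \<alpha> :: "'p \<Rightarrow> real" and \<beta> i j
    assume pot: "\<forall>(i, j)\<in>- Z. \<alpha> i + \<beta> j = 0"
    show "\<alpha> i + \<beta> j = 0"
    proof (cases "(i, j) \<in> Z")
      case False
      then show ?thesis using pot by blast
    next
      case True
      then obtain y where y: "y \<in> balanced" "restrict_mat Z y = ind_mat {(i, j)}" using ex by blast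
      \<comment> \<open>The potential vanishes off \<open>Z\<close> and \<open>y\<close> is a unit
        at \<open>(i, j)\<close> on \<open>Z\<close>, so the pairing returns the value of the
        potential at \<open>(i, j)\<close>.\<close>
      have "(\<Sum>e\<in>UNIV. (\<alpha> (fst e) + \<beta> (snd e)) * entry y e) =
          (\<Sum>e\<in>UNIV. if e = (i, j) then \<alpha> i + \<beta> j else 0)"
      proof (rule sum.cong[OF refl])
        fix e
        show "(\<alpha> (fst e) + \<beta> (snd e)) * entry y e = (if e = (i, j) then \<alpha> i + \<beta> j else 0)"
        proof (cases "e \<in> Z")
          case True
          then show ?thesis using arg_cong[OF y(2), of "\<lambda>z. entry z e"] by (simp split: if_splits)
        next
          case False
          moreover have "e \<noteq> (i, j)" using False \<open>(i, j) \<in> Z\<close> by blast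
          ultimately show ?thesis using bspec[OF pot, of e] by (simp add: split_beta)
        qed
      qed
      then show ?thesis using potential_orthogonal_balanced[OF y(1)] by simp
    qed
  qed
  then show ?thesis using indep unfolding tree_def Z_def by blast
qed

subsection \<open>Generic directions\<close>

text \<open>Finitely many hyperplanes form a null set and cannot cover a nonempty open set.\<close>

lemma generic_point_exists:
  fixes U :: "'a::euclidean_space set" and \<Phi> :: "('a \<Rightarrow> real) set"
  assumes "open U" "U \<noteq> {}" "finite \<Phi>"
    and lin: "\<And>\<phi>. \<phi> \<in> \<Phi> \<Longrightarrow> linear \<phi>" and nz: "\<And>\<phi>. \<phi> \<in> \<Phi> \<Longrightarrow> \<exists>z. \<phi> z \<noteq> 0"
  shows "\<exists>y\<in>U. \<forall>\<phi>\<in>\<Phi>. \<phi> y \<noteq> 0"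
proof (rule ccontr)
  assume "\<not> ?thesis"
  then have "U \<subseteq> (\<Union>\<phi>\<in>\<Phi>. {y. \<phi> y = 0})" by blast
  moreover have "negligible {y. \<phi> y = 0}" if "\<phi> \<in> \<Phi>" for \<phi>
  proof -
    have eq: "\<phi> y = adjoint \<phi> 1 \<bullet> y" for y
      using adjoint_works[OF lin[OF that], of y 1] by (simp add: inner_commute)
    moreover have "adjoint \<phi> 1 \<noteq> 0" using nz[OF that] eq by auto
    ultimately show ?thesis using negligible_hyperplane[of "adjoint \<phi> 1" 0] by simp
  qed
  then have "negligible (\<Union>\<phi>\<in>\<Phi>. {y. \<phi> y = 0})"
    using assms(3) by (intro negligible_Union) auto
  ultimately show False
    using open_not_negligible[OF assms(1,2)] negligible_subset by blast
qed

text \<open>Strict signs at \<open>y0\<close> persist nearby by continuity; the other requirements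
  exclude finitely many hyperplanes.\<close>

lemma generic_direction_exists:
  fixes x0 y0 :: "real ^ 'q ^ 'p"
  assumes i: "(\<Sum>j\<in>UNIV. y0 $ i $ j) < 0"
  obtains y where "(\<Sum>j\<in>UNIV. y $ i $ j) < 0"
    and "\<And>T e. tree T \<Longrightarrow> entry (flow T y0) e > 0 \<Longrightarrow> entry (flow T y) e > 0"
    and "\<And>T e. tree T \<Longrightarrow> entry (flow T y0) e < 0 \<Longrightarrow> entry (flow T y) e < 0"
    and "\<And>T e. tree T \<Longrightarrow> e \<in> T \<Longrightarrow> entry (flow T y) e \<noteq> 0"
    and "\<And>T e e'. tree T \<Longrightarrow> e \<in> T \<Longrightarrow> e' \<in> T \<Longrightarrow> e \<noteq> e' \<Longrightarrow>
      entry (flow T x0) e \<noteq> 0 \<or> entry (flow T x0) e' \<noteq> 0 \<Longrightarrow>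
      entry (flow T x0) e * entry (flow T y) e' \<noteq> entry (flow T x0) e' * entry (flow T y) e"
proof -
  have lin: "linear (\<lambda>y. entry (flow T y) e)" if "tree T" for T :: "('p \<times> 'q) set" and e
    using linear_compose[OF linear_flow[OF that] linear_entry, of e] by (simp add: o_def)
  have cont: "((\<lambda>y. entry (flow T y) e) \<longlongrightarrow> entry (flow T y0) e) (nhds y0)"
    if "tree T" for T :: "('p \<times> 'q) set" and e
    using linear_continuous_at[OF lin[OF that, unfolded linear_conv_bounded_linear], of y0 e]
    by (simp add: continuous_at tendsto_nhds_iff)
  have ev1: "\<forall>\<^sub>F y in nhds y0. (\<Sum>j\<in>UNIV. y $ i $ j) < 0"
    by (rule order_tendstoD(2)[OF _ i]) (intro tendsto_intros filterlim_ident)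
  have ev2: "\<forall>\<^sub>F y in nhds y0. (entry (flow T y0) e > 0 \<longrightarrow> entry (flow T y) e > 0) \<and>
      (entry (flow T y0) e < 0 \<longrightarrow> entry (flow T y) e < 0)" if "tree T" for T :: "('p \<times> 'q) set" and e
    using order_tendstoD(1)[OF cont[OF that, of e], of 0] order_tendstoD(2)[OF cont[OF that, of e], of 0]
    by (cases "entry (flow T y0) e" "0::real" rule: linorder_cases) auto
  have "\<forall>\<^sub>F y in nhds y0. (\<Sum>j\<in>UNIV. y $ i $ j) < 0 \<and> (\<forall>T\<in>Collect tree. \<forall>e\<in>UNIV.
      (entry (flow T y0) e > 0 \<longrightarrow> entry (flow T y) e > 0) \<and>
      (entry (flow T y0) e < 0 \<longrightarrow> entry (flow T y) e < 0))"
    by (rule eventually_conj[OF ev1], intro eventually_ball_finite ballI ev2) simp_all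
  then obtain U where U: "open U" "y0 \<in> U"
    "\<And>y. y \<in> U \<Longrightarrow> (\<Sum>j\<in>UNIV. y $ i $ j) < 0 \<and> (\<forall>T\<in>Collect tree. \<forall>e\<in>UNIV.
      (entry (flow T y0) e > 0 \<longrightarrow> entry (flow T y) e > 0) \<and>
      (entry (flow T y0) e < 0 \<longrightarrow> entry (flow T y) e < 0))"
    unfolding eventually_nhds by blast
  define \<Phi>1 where "\<Phi>1 = (\<lambda>(T, e) y. entry (flow T y) e) ` (SIGMA T:(Collect tree :: ('p \<times> 'q) set set). T)"
  define Q where "Q = {(T :: ('p \<times> 'q) set, e, e'). tree T \<and> e \<in> T \<and> e' \<in> T \<and> e \<noteq> e' \<and>
      (entry (flow T x0) e \<noteq> 0 \<or> entry (flow T x0) e' \<noteq> 0)}"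
  define \<Phi>2 where "\<Phi>2 = (\<lambda>(T, e, e') y. entry (flow T x0) e * entry (flow T y) e' -
      entry (flow T x0) e' * entry (flow T y) e) ` Q"
  \<comment> \<open>Test matrices showing that the functionals are not identically zero: a unit on
    an edge of \<open>T\<close> is its own flow.\<close>
  have flow_ind: "entry (flow T (ind_mat {e})) e' = (if e' = e then 1 else 0)" if "tree T" "e \<in> T"
    for T :: "('p \<times> 'q) set" and e e'
    using flow_supported[OF that(1) ind_mat_supported[of "{e}" T]] that(2) by simp
  have "\<exists>y\<in>U. \<forall>\<phi>\<in>\<Phi>1 \<union> \<Phi>2. \<phi> y \<noteq> 0"
  proof (rule generic_point_exists[OF U(1)])
    show "U \<noteq> {}" using U(2) by blast
    show "finite (\<Phi>1 \<union> \<Phi>2)" by (auto simp: \<Phi>1_def \<Phi>2_def)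
    fix \<phi> :: "real ^ 'q ^ 'p \<Rightarrow> real" assume "\<phi> \<in> \<Phi>1 \<union> \<Phi>2"
    then consider T e where "tree T" "e \<in> T" "\<phi> = (\<lambda>y. entry (flow T y) e)"
      | T e e' where "(T, e, e') \<in> Q" "\<phi> = (\<lambda>y. entry (flow T x0) e * entry (flow T y) e' -
          entry (flow T x0) e' * entry (flow T y) e)"
      unfolding \<Phi>1_def \<Phi>2_def by auto
    then have "linear \<phi> \<and> (\<exists>z. \<phi> z \<noteq> 0)"
    proof cases
      case 1
      then show ?thesis using lin[of T e] flow_ind[of T e e] by (metis zero_neq_one)
    next
      case 2
      then have Q: "tree T" "e \<in> T" "e' \<in> T" "e \<noteq> e'"
        "entry (flow T x0) e \<noteq> 0 \<or> entry (flow T x0) e' \<noteq> 0"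
        by (auto simp: Q_def)
      have "linear \<phi>" unfolding 2(2)
        by (intro linear_compose_sub linear_compose_scale_right[where f = "\<lambda>y. entry (flow T y) _", simplified] lin Q)
      moreover have "\<phi> (ind_mat {e'}) = entry (flow T x0) e" "\<phi> (ind_mat {e}) = - entry (flow T x0) e'"
        using Q by (simp_all add: 2 flow_ind)
      ultimately show ?thesis using Q(5) by (metis neg_equal_0_iff_equal)
    qed
    then show "linear \<phi>" "\<exists>z. \<phi> z \<noteq> 0" by blast+
  qed
  then obtain y where y: "y \<in> U" "\<And>\<phi>. \<phi> \<in> \<Phi>1 \<Longrightarrow> \<phi> y \<noteq> 0" "\<And>\<phi>. \<phi> \<in> \<Phi>2 \<Longrightarrow> \<phi> y \<noteq> 0" by blast
  show thesis
  proof (rule that[of y])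
    show "entry (flow T y) e \<noteq> 0" if "tree T" "e \<in> T" for T e
      using y(2)[of "\<lambda>y. entry (flow T y) e"] that by (force simp: \<Phi>1_def)
    show "entry (flow T x0) e * entry (flow T y) e' \<noteq> entry (flow T x0) e' * entry (flow T y) e"
      if "tree T" "e \<in> T" "e' \<in> T" "e \<noteq> e'" "entry (flow T x0) e \<noteq> 0 \<or> entry (flow T x0) e' \<noteq> 0"
      for T e e'
    proof -
      have "(T, e, e') \<in> Q" using that by (simp add: Q_def)
      then have "(\<lambda>y. entry (flow T x0) e * entry (flow T y) e' - entry (flow T x0) e' * entry (flow T y) e) \<in> \<Phi>2"
        unfolding \<Phi>2_def by force
      from y(3)[OF this] show ?thesis by simp
    qed
  qed (use U(3)[OF y(1)] in auto)
qed

text \<open>Raising the marginals along \<open>ind_mat (- S)\<close> amounts to relaxing the redundant inequalities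
  \<open>x\<^sub>e \<ge> 0\<close> to \<open>x\<^sub>e \<ge> - t\<close>, which changes neither the vertices nor the facets; subtracting a multiple of
  \<open>x0\<close> only rescales the polytope. So every vertex of \<open>P\<close> survives as exactly one tree.\<close>

lemma bij_betw_vertices_trees:
  fixes P :: "(real ^ 'q ^ 'p) set"
  assumes "x0 \<in> P" and P: "P = {x. x - x0 \<in> balanced \<and> (\<forall>e. 0 \<le> entry x e)}"
    and PS: "P = {x. x - x0 \<in> balanced \<and> (\<forall>e\<in>S. 0 \<le> entry x e)}"
    and tree: "\<And>x. x extreme_point_of P \<Longrightarrow> tree (- (S \<inter> {e. entry x e = 0}))"
    and pos: "\<And>T e. tree T \<Longrightarrow> entry (flow T (ind_mat (- S) - K *\<^sub>R x0)) e > 0 \<Longrightarrow> entry (flow T y) e > 0"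
    and neg: "\<And>T e. tree T \<Longrightarrow> entry (flow T (ind_mat (- S) - K *\<^sub>R x0)) e < 0 \<Longrightarrow> entry (flow T y) e < 0"
  shows "bij_betw (\<lambda>x. - (S \<inter> {e. entry x e = 0})) (vertices P)
    {T. tree T \<and> (\<forall>e\<in>T. entry (flow T x0) e > 0 \<or> entry (flow T x0) e = 0 \<and> entry (flow T y) e > 0)}"
proof -
  \<comment> \<open>Edges outside \<open>S\<close> stay in the tree even where \<open>x\<close>
    vanishes.\<close>
  define tr where "tr x = - (S \<inter> {e. entry x e = 0})" for x :: "real ^ 'q ^ 'p"
  have flow_y0: "flow T (ind_mat (- S) - K *\<^sub>R x0) = flow T (ind_mat (- S)) - K *\<^sub>R flow T x0"
    if "tree T" for T
    by (simp add: linear_diff[OF linear_flow[OF that]] linear_scale[OF linear_flow[OF that]])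
  have vertex: "tree (tr x)" "flow (tr x) x0 = x" "\<And>e. 0 \<le> entry x e" if "x \<in> vertices P" for x
  proof -
    have x: "x extreme_point_of P" "x \<in> P" using that by (auto simp: vertices_def extreme_point_of_def)
    show "tree (tr x)" using tree[OF x(1)] by (simp add: tr_def)
    then show "flow (tr x) x0 = x"
      using x(2) by (intro flow_eqI supportedI) (auto simp: tr_def P)
    show "0 \<le> entry x e" for e using x(2) P by blast
  qed
  have "bij_betw tr (vertices P)
    {T. tree T \<and> (\<forall>e\<in>T. entry (flow T x0) e > 0 \<or> entry (flow T x0) e = 0 \<and> entry (flow T y) e > 0)}"
  proof (rule bij_betw_imageI)
    show "inj_on tr (vertices P)"
      by (rule inj_onI) (metis vertex(2))
    show "tr ` vertices P =
      {T. tree T \<and> (\<forall>e\<in>T. entry (flow T x0) e > 0 \<or> entry (flow T x0) e = 0 \<and> entry (flow T y) e > 0)}"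
    proof (intro subset_antisym subsetI)
      fix T assume "T \<in> tr ` vertices P"
      then obtain x where x: "x \<in> vertices P" "T = tr x" by blast
      have T: "tree T" "flow T x0 = x" using vertex x by simp_all
      \<comment> \<open>Such an edge lies outside \<open>S\<close>. As \<open>T\<close> contains the
        complement of \<open>S\<close>, \<open>ind_mat (- S)\<close> is its own flow, with value 1
        on \<open>e\<close>, and the multiple of \<open>x0\<close> contributes 0.\<close>
      have "entry (flow T y) e > 0" if "e \<in> T" "entry x e = 0" for e
      proof -
        have "flow T (ind_mat (- S)) = ind_mat (- S)"
          by (rule flow_supported[OF T(1) ind_mat_supported]) (auto simp: x tr_def)
        moreover have "e \<notin> S" using that by (simp add: x(2) tr_def)
        ultimately show ?thesis using that T by (intro pos) (simp_all add: flow_y0)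
      qed
      then show "T \<in> {T. tree T \<and> (\<forall>e\<in>T. entry (flow T x0) e > 0 \<or> entry (flow T x0) e = 0 \<and> entry (flow T y) e > 0)}"
        using T vertex(3)[OF x(1)] by (auto simp: order_le_less)
    next
      fix T :: "('p \<times> 'q) set"
      assume "T \<in> {T. tree T \<and> (\<forall>e\<in>T. entry (flow T x0) e > 0 \<or> entry (flow T x0) e = 0 \<and> entry (flow T y) e > 0)}"
      then have T: "tree T" and
        alive: "\<And>e. e \<in> T \<Longrightarrow> entry (flow T x0) e > 0 \<or> entry (flow T x0) e = 0 \<and> entry (flow T y) e > 0"
        by auto
      define x where "x = flow T x0"
      have xe: "0 \<le> entry x e" for e
        using alive[of e] flow_outside[OF T, of e x0] unfolding x_def by (cases "e \<in> T") auto
      have xP: "x \<in> P" using xe flow_props(2)[OF T, of x0] by (simp add: P x_def)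
      have "x extreme_point_of P"
        unfolding extreme_point_of_def
      proof (intro conjI ballI notI xP)
        fix a b assume ab: "a \<in> P" "b \<in> P" "x \<in> open_segment a b"
        then obtain s where s: "0 < s" "s < 1" "x = (1 - s) *\<^sub>R a + s *\<^sub>R b" "a \<noteq> b"
          by (auto simp: in_segment)
        have "entry a e = 0 \<and> entry b e = 0" if "e \<notin> T" for e
        proof -
          have "(1 - s) * entry a e + s * entry b e = 0"
            using flow_outside[OF T that, of x0] s(3) unfolding x_def by (metis entry_simps(1,3))
          moreover have "0 \<le> entry a e" "0 \<le> entry b e" using ab(1,2) P by blast+
          then have "0 \<le> (1 - s) * entry a e" "0 \<le> s * entry b e" using s(1,2) by simp_all
          ultimately have "(1 - s) * entry a e = 0" "s * entry b e = 0" by linarith+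
          then show ?thesis using s by simp
        qed
        then have "a \<in> supported T" "b \<in> supported T" by (auto intro: supportedI)
        then have "a = b" using flow_unique[OF T, of a b x0] ab by (simp add: P)
        with s(4) show False ..
      qed
      then have xv: "x \<in> vertices P" by (simp add: vertices_def)
      define z where "z = flow T (ind_mat (- S))"
      \<comment> \<open>Where \<open>x\<close> is 0, the multiple of \<open>x0\<close> contributes
        nothing, so a negative \<open>z\<close> on \<open>T\<close> would pass to \<open>y\<close>
        by \<open>neg\<close> and contradict aliveness.\<close>
      have z: "0 \<le> entry z e" if "entry x e = 0" for e
      proof (cases "e \<in> T")
        case True
        then have "entry (flow T y) e > 0" using alive[OF True] that by (simp add: x_def)
        then have "\<not> entry (flow T (ind_mat (- S) - K *\<^sub>R x0)) e < 0" using neg[OF T, of e] by linarith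
        then show ?thesis using that by (simp add: flow_y0[OF T] z_def x_def)
      qed (simp add: z_def flow_outside[OF T])
      \<comment> \<open>Moving \<open>x\<close> along \<open>z - ind_mat (- S)\<close> keeps the
        marginals, and on \<open>S\<close> the second matrix is 0. Once the moved point satisfies
        the inequalities in \<open>S\<close>, it lies in \<open>P\<close>, and so its entries
        outside \<open>S\<close> are nonnegative too.\<close>
      have "\<exists>\<delta>>0. \<forall>e\<in>S. 0 \<le> entry x e + \<delta> * entry (z - ind_mat (- S)) e"
      proof (rule small_step)
        fix e assume "e \<in> S"
        then show "0 < entry x e \<or> entry x e = 0 \<and> 0 \<le> entry (z - ind_mat (- S)) e"
          using z[of e] xe[of e] by (cases "entry x e = 0") simp_all
      qed simp
      then obtain \<delta> where \<delta>: "\<delta> > 0" "\<And>e. e \<in> S \<Longrightarrow> 0 \<le> entry x e + \<delta> * entry (z - ind_mat (- S)) e"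
        by blast
      have "(x - x0) + \<delta> *\<^sub>R (z - ind_mat (- S)) \<in> balanced"
        unfolding x_def z_def by (intro subspace_add subspace_scale subspace_balanced flow_props(2) T)
      then have bal: "x + \<delta> *\<^sub>R (z - ind_mat (- S)) - x0 \<in> balanced"
        by (simp only: diff_add_eq)
      have "0 \<le> entry (x + \<delta> *\<^sub>R (z - ind_mat (- S))) e" if "e \<in> S" for e
        using \<delta>(2)[OF that] by simp
      with bal have "x + \<delta> *\<^sub>R (z - ind_mat (- S)) \<in> P"
        unfolding PS by blast
      then have nonneg: "0 \<le> entry (x + \<delta> *\<^sub>R (z - ind_mat (- S))) e" for e
        unfolding P by blast
      \<comment> \<open>On an edge of \<open>tr x\<close> outside \<open>T\<close> both
        \<open>x\<close> and \<open>z\<close> are 0, hence it is not in \<open>S\<close>, and the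
        moved point would have the entry -\<delta> there.\<close>
      have "tr x \<subseteq> T"
      proof (rule ccontr)
        assume "\<not> tr x \<subseteq> T"
        then obtain e where e: "e \<in> tr x" "e \<notin> T" by blast
        then have "entry x e = 0" "entry z e = 0" using flow_outside[OF T] by (simp_all add: x_def z_def)
        moreover from this have "e \<notin> S" using e(1) by (simp add: tr_def)
        ultimately have "\<delta> \<le> 0" using nonneg[of e] by simp
        with \<delta>(1) show False by simp
      qed
      then have "tr x = T"
        using vertex(1)[OF xv] T by (intro tree_subset_eq) (auto simp: tree_def)
      with xv show "T \<in> tr ` vertices P" by blast
    qed
  qed
  then show ?thesis unfolding tr_def .
qed

theorem theorem3p1:
  fixes u :: "real ^ 'p" and v :: "real ^ 'q" and P :: "(real ^ 'q ^ 'p) set"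
  assumes "P = transportation_polytope u v"
    and "nondegenerate P"
  shows "gcd CARD('p) CARD('q) dvd card (vertices P)"
\<comment> \<open>For p = 1 or q = 1 the polytope is a point, possibly 0, and there may be no
  positive marginal to drive below zero; but the gcd is then 1. Otherwise the dimension is positive,
  which provides a row with \<open>u $ i > 0\<close>.\<close>
proof (cases "CARD('p) = 1 \<or> CARD('q) = 1")
  case True
  then have "gcd CARD('p) CARD('q) = 1" by auto
  then show ?thesis by simp
next
  case False
  moreover have "CARD('p) \<noteq> 0" "CARD('q) \<noteq> 0" by simp_all
  ultimately have ge2: "CARD('p) - 1 > 0" "CARD('q) - 1 > 0" by linarith+
  have simple: "simple_polytope P"
    and dim: "aff_dim P = (int CARD('p) - 1) * (int CARD('q) - 1)"
    using assms(2) by (auto simp: nondegenerate_def)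
  have dim': "(int CARD('p) - 1) * (int CARD('q) - 1) = int ((CARD('p) - 1) * (CARD('q) - 1))"
    using ge2 by (simp add: of_nat_diff)
  have dim_pos: "aff_dim P > 0" unfolding dim dim' using ge2 by (simp only: of_nat_0_less_iff nat_0_less_mult_iff)
  then have "P \<noteq> {}" by auto
  then obtain x0 where x0: "x0 \<in> P" by blast
  have P: "P = {x. x - x0 \<in> balanced \<and> (\<forall>e. 0 \<le> entry x e)}"
    unfolding assms(1) by (rule transportation_polytope_eq) (rule x0[unfolded assms(1)])
  have sub: "P \<subseteq> {x. x - x0 \<in> balanced}" by (subst P) blast
  have hull: "affine hull P = {x. x - x0 \<in> balanced}"
    and dimB: "dim (balanced :: (real ^ 'q ^ 'p) set) = (CARD('p) - 1) * (CARD('q) - 1)"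
    by (rule affine_hull_translate_balanced[OF x0 sub dim])+
  obtain S where PS: "P = {x. x - x0 \<in> balanced \<and> (\<forall>e\<in>S. 0 \<le> entry x e)}"
    and S: "\<And>x. x \<in> P \<Longrightarrow> card {F. F facet_of P \<and> x \<in> F} = card (S \<inter> {e. entry x e = 0})"
    by (rule facet_coordinates[OF x0 P hull]) (rule that; assumption)
  have tree: "tree (- (S \<inter> {e. entry x e = 0}))" if x: "x extreme_point_of P" for x
  proof (rule vertex_tree[OF PS x])
    have "int (card {F. F facet_of P \<and> x \<in> F}) = aff_dim P"
      using simple x by (simp add: simple_polytope_def vertices_def)
    also have "card {F. F facet_of P \<and> x \<in> F} = card (S \<inter> {e. entry x e = 0})"
      using x by (intro S) (simp only: extreme_point_of_def)
    finally show "card (S \<inter> {e. entry x e = 0}) = dim (balanced :: (real ^ 'q ^ 'p) set)"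
      unfolding dim dim' dimB of_nat_eq_iff .
  qed
  obtain i where i: "u $ i > 0"
  proof (rule ccontr)
    assume "\<not> thesis"
    then have neg: "u $ i \<le> 0" for i using that by (meson linorder_not_le)
    have "x = 0" if "x \<in> P" for x
    proof -
      have x: "\<And>i j. 0 \<le> x $ i $ j" "\<And>i. (\<Sum>j\<in>UNIV. x $ i $ j) = u $ i"
        using that by (auto simp: assms(1) transportation_polytope_def)
      have "(\<Sum>j\<in>UNIV. x $ i $ j) = 0" for i
        using neg[of i] x(2)[of i] sum_nonneg[of UNIV "\<lambda>j. x $ i $ j", OF x(1)] by linarith
      then have "x $ i $ j = 0" for i j
        using sum_nonneg_eq_0_iff[of UNIV "\<lambda>j. x $ i $ j"] x(1) by simp
      then show ?thesis by (simp add: vec_eq_iff)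
    qed
    then have "P \<subseteq> {0}" by blast
    then have "aff_dim P \<le> aff_dim {0 :: real ^ 'q ^ 'p}" by (rule aff_dim_subset)
    with dim_pos show False by simp
  qed
  \<comment> \<open>Row \<open>i\<close> of \<open>ind_mat (- S)\<close> sums to at most q, so
    subtracting \<open>K * u $ i\<close> = q + 1 makes the row sum of \<open>y0\<close>
    negative.\<close>
  define K where "K = (real CARD('q) + 1) / u $ i"
  define y0 where "y0 = ind_mat (- S) - K *\<^sub>R x0"
  have "(\<Sum>j\<in>UNIV. y0 $ i $ j) < 0"
  proof -
    have "(\<Sum>j\<in>UNIV. y0 $ i $ j) = (\<Sum>j\<in>UNIV. ind_mat (- S) $ i $ j) - K * (\<Sum>j\<in>UNIV. x0 $ i $ j)"
      by (simp add: y0_def sum_subtractf sum_distrib_left)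
    also have "(\<Sum>j\<in>UNIV. x0 $ i $ j) = u $ i"
      using x0 by (simp add: assms(1) transportation_polytope_def)
    also have "K * u $ i = real CARD('q) + 1" using i by (simp add: K_def)
    also have "(\<Sum>j\<in>UNIV. (ind_mat (- S) :: real ^ 'q ^ 'p) $ i $ j) \<le> (\<Sum>j\<in>(UNIV :: 'q set). 1)"
      by (rule sum_mono) (simp add: ind_mat_def)
    finally show ?thesis by simp
  qed
  then obtain y where y: "(\<Sum>j\<in>UNIV. y $ i $ j) < 0"
    "\<And>T e. tree T \<Longrightarrow> entry (flow T y0) e > 0 \<Longrightarrow> entry (flow T y) e > 0"
    "\<And>T e. tree T \<Longrightarrow> entry (flow T y0) e < 0 \<Longrightarrow> entry (flow T y) e < 0"
    "\<And>T e. tree T \<Longrightarrow> e \<in> T \<Longrightarrow> entry (flow T y) e \<noteq> 0"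
    "\<And>T e e'. tree T \<Longrightarrow> e \<in> T \<Longrightarrow> e' \<in> T \<Longrightarrow> e \<noteq> e' \<Longrightarrow>
      entry (flow T x0) e \<noteq> 0 \<or> entry (flow T x0) e' \<noteq> 0 \<Longrightarrow>
      entry (flow T x0) e * entry (flow T y) e' \<noteq> entry (flow T x0) e' * entry (flow T y) e"
    by (rule generic_direction_exists[where ?x0.0 = x0]) (rule that; assumption)
  have eq: "card (vertices P) = card {T. tree T \<and>
      (\<forall>e\<in>T. entry (flow T x0) e > 0 \<or> entry (flow T x0) e = 0 \<and> entry (flow T y) e > 0)}"
    by (rule bij_betw_same_card[OF bij_betw_vertices_trees[OF x0 P PS tree y(2,3)[unfolded y0_def]]])
  show ?thesis
    unfolding eq
  proof (rule card_alive_trees_dvd)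
    show "entry (flow T y) e \<noteq> 0" if "tree T" "e \<in> T" for T e
      using that by (rule y(4))
    show "entry (flow T x0) e * entry (flow T y) e' \<noteq> entry (flow T x0) e' * entry (flow T y) e"
      if "tree T" "e \<in> T" "e' \<in> T" "e \<noteq> e'" "entry (flow T x0) e \<noteq> 0 \<or> entry (flow T x0) e' \<noteq> 0"
      for T e e'
      using that by (rule y(5))
  qed (rule y(1))
qed

end
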